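(* Let $p$ be a prime number, let $s$ be an even positive divisor of $p-1$ such that $\frac{p-1}{s}$ is odd, and let $\mathbb{K}$ be the unique subfield of $\mathbb{Q}(\zeta_p)$ with $[\mathbb{K}:\mathbb{Q}]=s$. Let $\mathcal{M}_p\subseteq\mathcal{O}_{\mathbb{K}}$ be the $\mathbb{Z}$-submodule and $\sigma$ the canonical embedding defined in the context. Then the center density of the lattice $\sigma(\mathcal{M}_p)\subset\mathbb{R}^s$ satisfies $$\delta(\sigma(\mathcal{M}_p))\geq\frac{1}{2^{s/2}\sqrt{p}}.$$
   Context: Here $\zeta_p$ is a primitive $p$-th root of unity, $\mathbb{L}=\mathbb{Q}(\zeta_p)$, and $\mathcal{O}_{\mathbb{K}}$ is the ring of algebraic integers of $\mathbb{K}$. Let $u$ be an integer whose class generates $(\mathbb{Z}/p\mathbb{Z})^{\star}$, let $\sigma_u$ be the automorphism of $\mathbb{L}$ with $\sigma_u(\zeta_p)=\zeta_p^u$, let $\theta=\sigma_u|_{\mathbb{K}}$ (a generator of $\mathrm{Gal}(\mathbb{K}/\mathbb{Q})$), and let $t=\mathrm{Tr}_{\mathbb{L}/\mathbb{K}}(\zeta_p)$. The map $(a_0,\ldots,a_{s-1})\mapsto\sum_{i=0}^{s-1}a_i\theta^i(t)$ is an isomorphism of $\mathbb{Z}$-modules $\mathbb{Z}^s\to\mathcal{O}_{\mathbb{K}}$, and through it elements ${\bf x}\in\mathcal{O}_{\mathbb{K}}$ are identified with their coordinate vectors ${\bf x}=(a_0,\ldots,a_{s-1})\in\mathbb{Z}^s$.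 Let $\beta\in\mathbb{Z}$ be a primitive root modulo $p$ (of multiplicative order $p-1$ modulo $p$), and put $\alpha=\beta^{(p-1)/s}$. For $i=0,1,\ldots,s-1$ let $\mu_i=(1,\alpha^i,\alpha^{2i},\ldots,\alpha^{(s-1)i})\in\mathbb{Z}^s$, and let $\cdot$ denote the usual dot product on $\mathbb{Z}^s$. For $s$ even, $\mathcal{M}_p=\{{\bf x}\in\mathcal{O}_{\mathbb{K}}:{\bf x}\cdot\mu_i\equiv 0\pmod p\text{ for all } i=0,1,\ldots,\frac{s}{2}\}$. Canonical embedding: let $\sigma_1,\ldots,\sigma_s$ be the embeddings $\mathbb{K}\to\mathbb{C}$, with $\sigma_1,\ldots,\sigma_{r_1}$ real and $\sigma_{r_1+1},\ldots,\sigma_{r_1+r_2}$ representatives of the $r_2$ complex-conjugate pairs of non-real ones ($s=r_1+2r_2$). Then $\sigma:\mathbb{K}\to\mathbb{R}^s$ is $\sigma(x)=(\sigma_1(x),\ldots,\sigma_{r_1}(x),\mathrm{Re}\,\sigma_{r_1+1}(x),\mathrm{Im}\,\sigma_{r_1+1}(x),\ldots,\mathrm{Re}\,\sigma_{r_1+r_2}(x),\mathrm{Im}\,\sigma_{r_1+r_2}(x))$. For a full-rank lattice $\Lambda\subset\mathbb{R}^n$, the packing radius is $\rho=\frac12\min\{\|v\|:v\in\Lambda\setminus\{0\}\}$, the volume $\mathrm{vol}(\Lambda)$ is the square root of the determinant of a Gram matrix of a $\mathbb{Z}$-basis of $\Lambda$, and the center density is $\delta(\Lambda)=\rho^n/\mathrm{vol}(\Lambda)$.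 *)

theory Defs
  imports
    Complex_Main
    "HOL-Library.FuncSet"
    "HOL-Computational_Algebra.Polynomial"
    "HOL-Number_Theory.Number_Theory"
    "Jordan_Normal_Form.Matrix"
    "Jordan_Normal_Form.Determinant"
begin

section \<open>Subfields of the complex numbers\<close>

text \<open>
  Number fields are represented as subfields of the complex numbers, so that the cyclotomic
  field is generated by a primitive root of unity that is an actual complex number.
\<close>

definition primitive_root_of_unity :: "nat \<Rightarrow> complex \<Rightarrow> bool" where
  "primitive_root_of_unity n z \<longleftrightarrow> z ^ n = 1 \<and> (\<forall>k. 0 < k \<and> k < n \<longrightarrow> z ^ k \<noteq> 1)"

definition complex_subfield :: "complex set \<Rightarrow> bool" where
  "complex_subfield K \<longleftrightarrow> 1 \<in> K \<and>
     (\<forall>x\<in>K. \<forall>y\<in>K. x - y \<in> K) \<and>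
     (\<forall>x\<in>K. \<forall>y\<in>K. x * y \<in> K) \<and>
     (\<forall>x\<in>K. inverse x \<in> K)"

definition rat_adjoin :: "complex \<Rightarrow> complex set" where
  "rat_adjoin z = complex_subfield hull {z}"

text \<open>The library dimension is 0 in the infinite-dimensional case.\<close>

definition degree_over_rat :: "complex set \<Rightarrow> nat" where
  "degree_over_rat K = vector_space.dim (\<lambda>(q :: rat) (z :: complex). of_rat q * z) K"

definition ring_of_integers :: "complex set \<Rightarrow> complex set" where
  "ring_of_integers K = {x \<in> K. algebraic_int x}"

text \<open>
  Embeddings are made extensional (a fixed value outside the field), so that two of them are
  equal as HOL functions if and only if they agree on the field; the sum over embeddings
  in \<open>rel_trace\<close> and the enumeration of embeddings below depend on this.
\<close>

definition embeddings :: "complex set \<Rightarrow> (complex \<Rightarrow> complex) set" where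
  "embeddings K = {f \<in> extensional K. f 1 = 1 \<and>
     (\<forall>x\<in>K. \<forall>y\<in>K. f (x + y) = f x + f y) \<and>
     (\<forall>x\<in>K. \<forall>y\<in>K. f (x * y) = f x * f y)}"

definition field_automorphisms :: "complex set \<Rightarrow> (complex \<Rightarrow> complex) set" where
  "field_automorphisms K = {f \<in> embeddings K. f ` K = K}"

definition rel_trace :: "complex set \<Rightarrow> complex set \<Rightarrow> complex \<Rightarrow> complex" where
  "rel_trace L K x = (\<Sum>f \<in> {f \<in> embeddings L. \<forall>y\<in>K. f y = y}. f x)"

section \<open>The canonical embedding\<close>

text \<open>
  \<open>emb 0, \<dots>, emb (s - 1)\<close> lists the embeddings without repetition: first the real ones, then
  representatives of the complex-conjugate pairs, then their conjugates in the same order.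
\<close>

definition embedding_enumeration ::
  "complex set \<Rightarrow> nat \<Rightarrow> nat \<Rightarrow> nat \<Rightarrow> (nat \<Rightarrow> complex \<Rightarrow> complex) \<Rightarrow> bool" where
  "embedding_enumeration K s r1 r2 emb \<longleftrightarrow>
     s = r1 + 2 * r2 \<and>
     bij_betw emb {..<s} (embeddings K) \<and>
     (\<forall>j<r1. emb j ` K \<subseteq> \<real>) \<and>
     (\<forall>j\<in>{r1..<s}. \<not> emb j ` K \<subseteq> \<real>) \<and>
     (\<forall>j<r2. \<forall>x\<in>K. emb (r1 + r2 + j) x = cnj (emb (r1 + j) x))"

definition canonical_embedding ::
  "nat \<Rightarrow> nat \<Rightarrow> (nat \<Rightarrow> complex \<Rightarrow> complex) \<Rightarrow> complex \<Rightarrow> real vec" where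
  "canonical_embedding r1 r2 emb x = vec (r1 + 2 * r2) (\<lambda>i.
     if i < r1 then Re (emb i x)
     else if even (i - r1) then Re (emb (r1 + (i - r1) div 2) x)
     else Im (emb (r1 + (i - r1) div 2) x))"

section \<open>Lattices and center density\<close>

text \<open>The columns of \<open>B\<close> are a basis of the real space whose integer span is \<open>\<Lambda>\<close>.\<close>

definition is_lattice_basis :: "nat \<Rightarrow> real mat \<Rightarrow> real vec set \<Rightarrow> bool" where
  "is_lattice_basis n B \<Lambda> \<longleftrightarrow> B \<in> carrier_mat n n \<and> invertible_mat B \<and>
     \<Lambda> = {B *\<^sub>v map_vec real_of_int c | c. c \<in> carrier_vec n}"

definition full_rank_lattice :: "nat \<Rightarrow> real vec set \<Rightarrow> bool" where
  "full_rank_lattice n \<Lambda> \<longleftrightarrow> (\<exists>B. is_lattice_basis n B \<Lambda>)"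

definition lattice_volume :: "nat \<Rightarrow> real vec set \<Rightarrow> real" where
  "lattice_volume n \<Lambda> =
     (THE V. \<exists>B. is_lattice_basis n B \<Lambda> \<and> V = sqrt (det (transpose_mat B * B)))"

definition packing_radius :: "nat \<Rightarrow> real vec set \<Rightarrow> real" where
  "packing_radius n \<Lambda> = (LEAST r. \<exists>v \<in> \<Lambda> - {0\<^sub>v n}. r = sqrt (v \<bullet> v)) / 2"

definition center_density :: "nat \<Rightarrow> real vec set \<Rightarrow> real" where
  "center_density n \<Lambda> = packing_radius n \<Lambda> ^ n / lattice_volume n \<Lambda>"

section \<open>The submodule\<close>

text \<open>Primitive roots modulo \<open>p\<close>, also for negative integers.\<close>

definition int_primroot :: "nat \<Rightarrow> int \<Rightarrow> bool" where
  "int_primroot p g \<longleftrightarrow> residue_primroot p (nat (g mod int p))"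

definition mu_vec :: "nat \<Rightarrow> int \<Rightarrow> nat \<Rightarrow> int vec" where
  "mu_vec s \<alpha> i = vec s (\<lambda>j. \<alpha> ^ (j * i))"

text \<open>\<open>a\<close> is the coordinate vector of \<open>x\<close> with respect to the conjugates of \<open>t\<close> under \<open>\<theta>\<close>.\<close>

definition is_coord_vec ::
  "nat \<Rightarrow> (complex \<Rightarrow> complex) \<Rightarrow> complex \<Rightarrow> complex \<Rightarrow> int vec \<Rightarrow> bool" where
  "is_coord_vec s \<theta> t x a \<longleftrightarrow>
     a \<in> carrier_vec s \<and> x = (\<Sum>i<s. of_int (a $ i) * (\<theta> ^^ i) t)"

definition M_module ::
  "nat \<Rightarrow> nat \<Rightarrow> complex set \<Rightarrow> (complex \<Rightarrow> complex) \<Rightarrow> complex \<Rightarrow> int \<Rightarrow> complex set" where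
  "M_module p s K \<theta> t \<alpha> = {x \<in> ring_of_integers K. \<exists>a. is_coord_vec s \<theta> t x a \<and>
     (\<forall>i \<le> s div 2. [a \<bullet> mu_vec s \<alpha> i = 0] (mod int p))}"

end

theory Submission
  imports Defs "Jordan_Normal_Form.Char_Poly"
begin

text \<open>
  Write \<open>x = \<Sum>a\<^sub>i \<eta>\<^sub>i\<close> in the Gaussian periods \<open>\<eta>\<^sub>i = \<theta>\<^sup>i(t)\<close> and put \<open>m = (p - 1)/s\<close>. As \<open>m\<close> is odd,
  \<open>K\<close> is totally complex, and orthogonality of the periods gives
  \<open>\<parallel>\<sigma>(x)\<parallel>\<^sup>2 = (p \<Sum>a\<^sub>i\<^sup>2 - m (\<Sum>a\<^sub>i)\<^sup>2)/2\<close>. On \<open>M\<^sub>p\<close> both \<open>\<Sum>a\<^sub>i\<close> and, by Parseval's identity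
  modulo \<open>p\<close>, \<open>\<Sum>a\<^sub>i\<^sup>2\<close> vanish modulo \<open>p\<close>; hence the positive even integer in parentheses is
  divisible by \<open>2p\<^sup>2\<close> and nonzero vectors have norm at least \<open>p\<close>. The coordinate vectors of
  \<open>M\<^sub>p\<close> form the lattice of a Reed-Solomon code with \<open>s/2 + 1\<close> check equations, of index
  \<open>p\<close> to the power \<open>s/2 + 1\<close>, and the Gram matrix \<open>(p I - m J)/2\<close> of the periods has determinant
  \<open>p\<close> to the power \<open>s - 1\<close> divided by \<open>2\<^sup>s\<close>.

  The automorphism \<open>\<sigma>\<^sub>u\<close> is given, so the irreducibility of the cyclotomic polynomial is not
  needed: the conjugates of \<open>\<zeta>\<close> are available at once, and the coordinates of an element of
  \<open>L\<close> can be read off from its conjugates.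
\<close>

section \<open>Lattices and their volume\<close>

lemma invertible_mat_iff_det_nonzero:
  fixes B :: "'a :: field mat"
  assumes B: "B \<in> carrier_mat n n"
  shows "invertible_mat B \<longleftrightarrow> det B \<noteq> 0"
proof
  assume "invertible_mat B"
  then obtain C where C: "B * C = 1\<^sub>m n" "C * B = 1\<^sub>m (dim_row C)"
    using B by (auto simp: invertible_mat_def inverts_mat_def)
  from C(1) have "dim_col C = n" by (metis index_mult_mat(3) index_one_mat(3))
  moreover from C(2) B have "dim_row C = n" by (metis carrier_matD(2) index_mult_mat(3) index_one_mat(3))
  ultimately have "C \<in> carrier_mat n n" by auto
  then have "det B * det C = 1" using C(1) B by (metis det_mult det_one)
  then show "det B \<noteq> 0" by auto
next
  assume "det B \<noteq> 0"
  from det_non_zero_imp_unit[OF B this, of "()"] 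
  obtain C where "C \<in> carrier_mat n n" "C * B = 1\<^sub>m n" "B * C = 1\<^sub>m n"
    by (auto simp: Units_def ring_mat_def)
  then show "invertible_mat B" using B
    by (auto simp: invertible_mat_def inverts_mat_def)
qed

lemma index_mult_mat_sum:
  assumes "A \<in> carrier_mat n k" "B \<in> carrier_mat k m" "i < n" "j < m"
  shows "(A * B) $$ (i, j) = (\<Sum>l<k. A $$ (i, l) * B $$ (l, j))"
  using assms by (auto simp: scalar_prod_def lessThan_atLeast0 intro!: sum.cong)

lemma det_gram:
  fixes B :: "'a :: comm_ring_1 mat"
  assumes "B \<in> carrier_mat n n"
  shows "det (transpose_mat B * B) = (det B)\<^sup>2"
  using assms by (simp add: det_mult[of _ n] det_transpose power2_eq_square)

text \<open>Each column of \<open>B'\<close> is the image of a unit vector and so lies in the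
  lattice; its integer coordinates with respect to \<open>B\<close> form a column of
  \<open>U\<close>.\<close>

lemma lattice_basis_transition:
  assumes B: "is_lattice_basis n B \<Lambda>" and B': "is_lattice_basis n B' \<Lambda>"
  obtains U :: "int mat" where "U \<in> carrier_mat n n" "B' = B * map_mat real_of_int U"
proof -
  have Bc: "B \<in> carrier_mat n n" and B'c: "B' \<in> carrier_mat n n"
    using B B' by (auto simp: is_lattice_basis_def)
  have "\<exists>c. c \<in> carrier_vec n \<and> col B' j = B *\<^sub>v map_vec real_of_int c" if "j < n" for j
  proof -
    have "map_vec real_of_int (unit_vec n j) = unit_vec n j" by (auto simp: unit_vec_def)
    then have "B' *\<^sub>v unit_vec n j \<in> \<Lambda>"
      using B' unfolding is_lattice_basis_def
      by (metis (mono_tags, lifting) mem_Collect_eq unit_vec_carrier)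
    moreover have "B' *\<^sub>v unit_vec n j = col B' j"
      using B'c that by (intro eq_vecI) auto
    ultimately have "col B' j \<in> \<Lambda>" by simp
    then show ?thesis using B unfolding is_lattice_basis_def by auto
  qed
  then obtain c where c: "\<And>j. j < n \<Longrightarrow> c j \<in> carrier_vec n"
    "\<And>j. j < n \<Longrightarrow> col B' j = B *\<^sub>v map_vec real_of_int (c j)" by metis
  define U where "U = mat n n (\<lambda>(i, j). c j $ i)"
  have U: "U \<in> carrier_mat n n" by (simp add: U_def)
  have colU: "col (map_mat real_of_int U) j = map_vec real_of_int (c j)" if "j < n" for j
    using c(1)[OF that] that by (intro eq_vecI) (auto simp: U_def)
  have "B' = B * map_mat real_of_int U"
  proof (rule mat_col_eqI)
    fix j assume "j < dim_col (B * map_mat real_of_int U)"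
    then have j: "j < n" using U by simp
    have "col (B * map_mat real_of_int U) j = B *\<^sub>v col (map_mat real_of_int U) j"
      using Bc U j by (intro col_mult2[of _ n n _ n]) auto
    then show "col B' j = col (B * map_mat real_of_int U) j"
      using colU[OF j] c(2)[OF j] by simp
  qed (use Bc B'c U in auto)
  with U that show ?thesis by blast
qed

text \<open>The volume is a definite description, so independence of the basis must be shown. The
  determinants of the two transition matrices are integers with product 1, hence the Gram
  determinants agree.\<close>

lemma lattice_volume_eq:
  assumes B: "is_lattice_basis n B \<Lambda>"
  shows "lattice_volume n \<Lambda> = sqrt (det (transpose_mat B * B))"
  unfolding lattice_volume_def
proof (rule the_equality)
  show "\<exists>B'. is_lattice_basis n B' \<Lambda> \<and>
    sqrt (det (transpose_mat B * B)) = sqrt (det (transpose_mat B' * B'))"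
    using B by blast
next
  fix V assume "\<exists>B'. is_lattice_basis n B' \<Lambda> \<and> V = sqrt (det (transpose_mat B' * B'))"
  then obtain B' where B': "is_lattice_basis n B' \<Lambda>"
    and V: "V = sqrt (det (transpose_mat B' * B'))" by blast
  have Bc: "B \<in> carrier_mat n n" and B'c: "B' \<in> carrier_mat n n"
    using B B' by (auto simp: is_lattice_basis_def)
  obtain U where U: "U \<in> carrier_mat n n" "B' = B * map_mat real_of_int U"
    using lattice_basis_transition[OF B B'] .
  obtain W where W: "W \<in> carrier_mat n n" "B = B' * map_mat real_of_int W"
    using lattice_basis_transition[OF B' B] .
  have d1: "det B' = det B * of_int (det U)"
    using U Bc by (simp add: det_mult[of _ n])
  have d2: "det B = det B' * of_int (det W)"
    using W(1) B'c by (subst W(2)) (simp add: det_mult[of _ n])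
  have "det B \<noteq> 0" using B Bc invertible_mat_iff_det_nonzero is_lattice_basis_def by blast
  moreover have "det B * (real_of_int (det U) * real_of_int (det W)) = det B * 1"
    using d2 unfolding d1 by (simp add: mult.assoc)
  ultimately have "real_of_int (det U * det W) = 1" by simp
  then have "det U * det W = 1" by linarith
  then have "\<bar>det U\<bar> = 1" by (metis zdvd1_eq dvd_triv_left)
  then have "(det B')\<^sup>2 = (det B)\<^sup>2"
    using d1 by (simp add: power_mult_distrib) (metis of_int_1 of_int_power one_power2 power2_abs)
  then show "V = sqrt (det (transpose_mat B * B))"
    using V Bc B'c by (simp add: det_gram)
qed

text \<open>A \<open>LEAST\<close> over the reals has the expected value only if the minimum is
  attained. Squared norms that are halves of natural numbers guarantee this, by the well-ordering of
  the natural numbers.\<close>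

lemma packing_radius_ge:
  fixes \<Lambda> :: "real vec set"
  assumes ne: "\<Lambda> - {0\<^sub>v n} \<noteq> {}"
    and discrete: "\<And>v. v \<in> \<Lambda> \<Longrightarrow> \<exists>k::nat. v \<bullet> v = real k / 2"
    and lb: "\<And>v. v \<in> \<Lambda> - {0\<^sub>v n} \<Longrightarrow> d\<^sup>2 \<le> v \<bullet> v" and d: "d \<ge> 0"
  shows "packing_radius n \<Lambda> \<ge> d / 2"
proof -
  let ?P = "\<lambda>k::nat. \<exists>v \<in> \<Lambda> - {0\<^sub>v n}. v \<bullet> v = real k / 2"
  have "\<exists>k. ?P k" using ne discrete by blast
  then have least: "?P (LEAST k. ?P k)" by (rule LeastI_ex)
  then obtain v where v: "v \<in> \<Lambda> - {0\<^sub>v n}" "v \<bullet> v = real (LEAST k. ?P k) / 2" by blast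
  have "(LEAST r. \<exists>v \<in> \<Lambda> - {0\<^sub>v n}. r = sqrt (v \<bullet> v)) = sqrt (v \<bullet> v)"
  proof (rule Least_equality)
    show "\<exists>w\<in>\<Lambda> - {0\<^sub>v n}. sqrt (v \<bullet> v) = sqrt (w \<bullet> w)" using v by blast
  next
    fix r assume "\<exists>w \<in> \<Lambda> - {0\<^sub>v n}. r = sqrt (w \<bullet> w)"
    then obtain w where w: "w \<in> \<Lambda> - {0\<^sub>v n}" "r = sqrt (w \<bullet> w)" by blast
    obtain k where k: "w \<bullet> w = real k / 2" using discrete w by blast
    then have "?P k" using w by blast
    then have "(LEAST k. ?P k) \<le> k" by (rule Least_le)
    then show "sqrt (v \<bullet> v) \<le> r" using v(2) w k by simp
  qed
  moreover have "d \<le> sqrt (v \<bullet> v)" using lb[OF v(1)] d by (simp add: real_le_rsqrt)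
  ultimately show ?thesis unfolding packing_radius_def by simp
qed

text \<open>Multiplying by two unitriangular matrices makes the matrix triangular.\<close>

lemma det_scalar_minus_constant:
  fixes x y :: "'a :: comm_ring_1"
  assumes n: "n > 0"
  shows "det (mat n n (\<lambda>(i, j). (if i = j then x else 0) - y)) = x ^ (n - 1) * (x - of_nat n * y)"
proof -
  let ?A = "mat n n (\<lambda>(i, j). (if i = j then x else 0) - y)"
  \<comment> \<open>On the right, \<open>U\<close> replaces the last column by the sum of all
    columns; on the left, \<open>U'\<close> subtracts the last row from all others.\<close>
  define U :: "'a mat" where "U = mat n n (\<lambda>(i, j). if i = j \<or> j = n - 1 then 1 else 0)"
  define U' :: "'a mat" where "U' = mat n n (\<lambda>(i, j). if i = j then 1 else if j = n - 1 then -1 else 0)"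
  define T :: "'a mat" where "T = mat n n (\<lambda>(i, j).
     if i = j then (if i = n - 1 then x - of_nat n * y else x) else if i = n - 1 then - y else 0)"
  have cs: "?A \<in> carrier_mat n n" "U \<in> carrier_mat n n" "U' \<in> carrier_mat n n" "T \<in> carrier_mat n n"
    by (auto simp: U_def U'_def T_def)
  have row: "(U' * ?A) $$ (i, j) =
      (if i = n - 1 then (if j = n - 1 then x else 0) - y
       else (if i = j then x else 0) - (if j = n - 1 then x else 0))"
    if "i < n" "j < n" for i j
  proof -
    have "(U' * ?A) $$ (i, j) = (\<Sum>k<n. U' $$ (i, k) * ?A $$ (k, j))"
      using that cs by (intro index_mult_mat_sum)
    also have "\<dots> = (\<Sum>k<n. (if k = i then ?A $$ (i, j) else 0) +
        (if k = n - 1 then (if i = n - 1 then 0 else - ?A $$ (n - 1, j)) else 0))"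
      using that by (intro sum.cong) (auto simp: U'_def)
    also have "\<dots> = ?A $$ (i, j) + (if i = n - 1 then 0 else - ?A $$ (n - 1, j))"
      using that n by (simp add: sum.distrib)
    finally show ?thesis using that n by auto
  qed
  have "U' * ?A * U = T"
  proof (rule eq_matI)
    fix i j assume "i < dim_row T" "j < dim_col T"
    then have ij: "i < n" "j < n" by (auto simp: T_def)
    have "(U' * ?A * U) $$ (i, j) = (\<Sum>k<n. (U' * ?A) $$ (i, k) * U $$ (k, j))"
      using ij cs by (intro index_mult_mat_sum) auto
    also have "\<dots> = T $$ (i, j)"
    proof (cases "j = n - 1")
      case True
      then have "(\<Sum>k<n. (U' * ?A) $$ (i, k) * U $$ (k, j)) = (\<Sum>k<n. (U' * ?A) $$ (i, k))"
        using ij by (intro sum.cong) (auto simp: U_def)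
      also have "\<dots> = (\<Sum>k<n. if i = n - 1 then (if k = n - 1 then x else 0) - y
          else (if k = i then x else 0) - (if k = n - 1 then x else 0))"
        using ij by (intro sum.cong) (auto simp: row)
      also have "\<dots> = (if i = n - 1 then x - of_nat n * y else 0)"
        using n ij by (auto simp: sum_subtractf)
      finally show ?thesis using True ij by (auto simp: T_def)
    next
      case False
      then have "(\<Sum>k<n. (U' * ?A) $$ (i, k) * U $$ (k, j)) =
          (\<Sum>k<n. if k = j then (U' * ?A) $$ (i, j) else 0)"
        using ij by (intro sum.cong) (auto simp: U_def)
      also have "\<dots> = (U' * ?A) $$ (i, j)" using ij by simp
      finally show ?thesis using False ij by (auto simp: row T_def)
    qed
    finally show "(U' * ?A * U) $$ (i, j) = T $$ (i, j)" .
  qed (use cs in auto)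
  moreover have "det U = 1"
    by (subst det_upper_triangular[of _ n]) (auto simp: U_def prod_list_diag_prod)
  moreover have "det U' = 1"
    by (subst det_upper_triangular[of _ n]) (auto simp: U'_def prod_list_diag_prod)
  moreover have "det T = x ^ (n - 1) * (x - of_nat n * y)"
  proof -
    have "det T = (\<Prod>i<n. T $$ (i, i))"
      by (subst det_lower_triangular[of n])
        (auto simp: T_def prod_list_diag_prod lessThan_atLeast0)
    also have "\<dots> = (\<Prod>i<Suc (n - 1). if i = n - 1 then x - of_nat n * y else x)"
      using n by (intro prod.cong) (auto simp: T_def)
    also have "\<dots> = x ^ (n - 1) * (x - of_nat n * y)"
      by (subst prod.lessThan_Suc) simp
    finally show ?thesis .
  qed
  moreover have "det (U' * ?A * U) = det U' * det ?A * det U"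
    using cs by (simp only: det_mult[of _ n] mult_carrier_mat[of _ n n])
  ultimately show ?thesis by simp
qed

section \<open>Reed-Solomon codes and their lattices\<close>

text \<open>Synthetic division at the last point stays within integer polynomials. The quotient
  vanishes modulo \<open>p\<close> at the remaining points, because the differences of the points
  are prime to \<open>p\<close>, and the induction hypothesis applies to it.\<close>

lemma prime_dvd_coeffs_of_roots:
  fixes f :: "int poly" and x :: "nat \<Rightarrow> int"
  assumes p: "prime p"
    and "f = 0 \<or> degree f < n"
    and "\<And>i. i < n \<Longrightarrow> p dvd poly f (x i)"
    and "\<And>i j. i < j \<Longrightarrow> j < n \<Longrightarrow> \<not> p dvd x j - x i"
  shows "p dvd coeff f l"
  using assms(2-4)
proof (induction n arbitrary: f l)
  case 0
  then show ?case by simp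
next
  case (Suc n)
  define g where "g = synthetic_div f (x n)"
  have f: "f + smult (x n) g = pCons (poly f (x n)) g"
    unfolding g_def by (rule synthetic_div_correct)
  have ev: "poly f y = poly f (x n) + (y - x n) * poly g y" for y
    using arg_cong[OF f, of "\<lambda>h. poly h y"] by (simp add: algebra_simps)
  have gdvd: "p dvd coeff g l" for l
  proof (rule Suc.IH)
    show "g = 0 \<or> degree g < n"
      using Suc.prems(1) unfolding g_def
      by (cases "degree f = 0") (auto simp: degree_synthetic_div synthetic_div_eq_0_iff)
  next
    fix i assume i: "i < n"
    have "p dvd (x i - x n) * poly g (x i)"
      using ev[of "x i"] Suc.prems(2)[of i] Suc.prems(2)[of n] i
      by (metis add_diff_cancel_left' dvd_diff less_Suc_eq)
    moreover have "\<not> p dvd x i - x n"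
      using Suc.prems(3)[of i n] i by (metis dvd_diff_commute lessI)
    ultimately show "p dvd poly g (x i)" using p prime_dvd_mult_iff by blast
  qed (use Suc.prems in auto)
  have "coeff f l = coeff (pCons (poly f (x n)) g) l - x n * coeff g l"
    using arg_cong[OF f, of "\<lambda>h. coeff h l"] by simp
  moreover have "p dvd coeff (pCons (poly f (x n)) g) l"
    using gdvd Suc.prems(2)[of n] by (cases l) auto
  ultimately show ?case using gdvd by simp
qed

text \<open>The Cauchy-Schwarz inequality against the all-ones vector, obtained by expanding a
  double sum of squared differences.\<close>

lemma square_sum_le_card_sum_squares:
  fixes a :: "'b \<Rightarrow> 'a :: linordered_idom"
  shows "(\<Sum>i\<in>I. a i)\<^sup>2 \<le> of_nat (card I) * (\<Sum>i\<in>I. (a i)\<^sup>2)"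
proof -
  have "0 \<le> (\<Sum>i\<in>I. \<Sum>j\<in>I. (a i - a j)\<^sup>2)" by (intro sum_nonneg) auto
  also have "\<dots> = (\<Sum>i\<in>I. \<Sum>j\<in>I. (a i)\<^sup>2 + (a j)\<^sup>2 - 2 * (a i * a j))"
    by (simp add: power2_diff algebra_simps)
  also have "\<dots> = 2 * (of_nat (card I) * (\<Sum>i\<in>I. (a i)\<^sup>2)) - 2 * (\<Sum>i\<in>I. a i)\<^sup>2"
    by (simp add: sum_subtractf sum.distrib sum_distrib_left[symmetric] 
        sum_distrib_right[symmetric] power2_eq_square)
  finally show ?thesis by simp
qed

text \<open>The congruence condition says that \<alpha> has multiplicative order \<open>s\<close>
  modulo \<open>p\<close>, in a form that compares exponents directly.\<close>

locale root_code =
  fixes p :: int and s :: nat and \<alpha> :: int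
  assumes p: "prime p" and s: "s > 0"
    and power_cong_iff: "\<And>a b. [\<alpha> ^ a = \<alpha> ^ b] (mod p) \<longleftrightarrow> [a = b] (mod s)"
begin

text \<open>The parity checks of a Reed-Solomon code: the polynomial with coefficients
  \<open>a j\<close> vanishes modulo \<open>p\<close> at the first \<open>k\<close> powers of
  \<alpha>. Values of \<open>a\<close> from \<open>s\<close> on are ignored.\<close>

definition code :: "nat \<Rightarrow> (nat \<Rightarrow> int) set" where
  "code k = {a. \<forall>i<k. p dvd (\<Sum>j<s. a j * \<alpha> ^ (j * i))}"

definition locator :: "nat \<Rightarrow> int poly" where
  "locator k = (\<Prod>i<k. [:- (\<alpha> ^ i), 1:])"

lemma locator_monic: "lead_coeff (locator k) = 1"
  unfolding locator_def by (simp add: lead_coeff_prod)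

lemma locator_nonzero: "locator k \<noteq> 0"
  using locator_monic[of k] by auto

lemma degree_locator: "degree (locator k) = k"
  unfolding locator_def by (subst degree_prod_eq_sum_degree) auto

lemma locator_root: "i < k \<Longrightarrow> poly (locator k) (\<alpha> ^ i) = 0"
  unfolding locator_def by (force simp: poly_prod)

text \<open>The first \<open>k\<close> columns are \<open>p\<close> times unit vectors, the others
  are the shifts of the locator. As the locator is monic of degree \<open>k\<close>, the matrix is
  upper triangular with diagonal entries \<open>p\<close> and 1, which makes the index of the code
  visible.\<close>

definition generator_mat :: "nat \<Rightarrow> int mat" where
  "generator_mat k = mat s s (\<lambda>(i, j).
     if j < k then (if i = j then p else 0)
     else if j - k \<le> i then coeff (locator k) (i - (j - k)) else 0)"

lemma det_generator_mat:
  assumes "k \<le> s"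
  shows "det (generator_mat k) = p ^ k"
proof -
  have "det (generator_mat k) = (\<Prod>i<s. generator_mat k $$ (i, i))"
  proof (subst det_upper_triangular[of _ s])
    show "upper_triangular (generator_mat k)"
      using degree_locator[of k] by (auto simp: generator_mat_def coeff_eq_0)
  qed (auto simp: generator_mat_def prod_list_diag_prod lessThan_atLeast0)
  also have "\<dots> = (\<Prod>i<s. if i < k then p else 1)"
    using locator_monic[of k] by (intro prod.cong) (auto simp: generator_mat_def degree_locator)
  also have "\<dots> = (\<Prod>i\<in>{..<s} \<inter> {i. i < k}. p)"
    by (subst prod.inter_filter[symmetric]) (auto intro!: prod.cong simp: Int_def)
  also have "{..<s} \<inter> {i. i < k} = {..<k}" using assms by auto
  finally show ?thesis by simp
qed

lemma not_cong_powers: "i < j \<Longrightarrow> j < s \<Longrightarrow> \<not> p dvd \<alpha> ^ j - \<alpha> ^ i"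
  using power_cong_iff[of j i] by (auto simp: cong_iff_dvd_diff[symmetric] cong_def)

text \<open>Vectors are read as polynomials here: the columns from \<open>k\<close> on contribute a
  multiple of the locator, the others a multiple of \<open>p\<close> in the degrees below
  \<open>k\<close>.\<close>

lemma coeff_mult_vec_generator_mat:
  assumes c: "c \<in> carrier_vec s" and k: "k \<le> s" and i: "i < s"
  shows "(generator_mat k *\<^sub>v c) $ i = (if i < k then p * c $ i else 0) +
    coeff (locator k * (\<Sum>j<s - k. monom (c $ (j + k)) j)) i"
proof -
  have "(generator_mat k *\<^sub>v c) $ i = (\<Sum>j<s. generator_mat k $$ (i, j) * c $ j)"
    using c i by (auto simp: generator_mat_def scalar_prod_def lessThan_atLeast0 intro!: sum.cong)
  also have "{..<s} = {..<k} \<union> {k..<s}" using k by auto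
  also have "(\<Sum>j\<in>{..<k} \<union> {k..<s}. generator_mat k $$ (i, j) * c $ j) =
     (\<Sum>j<k. generator_mat k $$ (i, j) * c $ j) + (\<Sum>j=k..<s. generator_mat k $$ (i, j) * c $ j)"
    by (subst sum.union_disjoint) auto
  also have "(\<Sum>j<k. generator_mat k $$ (i, j) * c $ j) = (\<Sum>j<k. if j = i then p * c $ i else 0)"
    using i k by (intro sum.cong) (auto simp: generator_mat_def)
  also have "\<dots> = (if i < k then p * c $ i else 0)" by simp
  also have "(\<Sum>j=k..<s. generator_mat k $$ (i, j) * c $ j) =
      (\<Sum>j<s - k. generator_mat k $$ (i, j + k) * c $ (j + k))"
    using k by (intro sum.reindex_bij_witness[of _ "\<lambda>j. j + k" "\<lambda>j. j - k"]) auto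
  also have "\<dots> = (\<Sum>j<s - k. coeff (monom (c $ (j + k)) j * locator k) i)"
    using i by (intro sum.cong) (auto simp: generator_mat_def coeff_monom_mult)
  also have "\<dots> = coeff (locator k * (\<Sum>j<s - k. monom (c $ (j + k)) j)) i"
    by (simp add: coeff_sum sum_distrib_left mult.commute)
  finally show ?thesis .
qed

lemma poly_eq_sum_lessThan:
  fixes f :: "int poly"
  assumes "f = 0 \<or> degree f < n"
  shows "poly f x = (\<Sum>j<n. coeff f j * x ^ j)"
proof -
  have "poly f x = (\<Sum>j\<le>degree f. coeff f j * x ^ j)" by (rule poly_altdef)
  also have "\<dots> = (\<Sum>j<n. coeff f j * x ^ j)"
    using assms by (intro sum.mono_neutral_cong)
      (auto simp: coeff_eq_0 not_le not_less intro: le_less_trans)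
  finally show ?thesis .
qed

text \<open>The multiple of the locator vanishes exactly at the first \<open>k\<close> powers of
  \<alpha>. Its degree is below \<open>s\<close>, so the sum over the first \<open>s\<close>
  coefficients is its full value.\<close>

lemma generator_mat_in_code:
  assumes c: "c \<in> carrier_vec s" and k: "k \<le> s"
  shows "($) (generator_mat k *\<^sub>v c) \<in> code k"
proof -
  define h where "h = (\<Sum>j<s - k. monom (c $ (j + k)) j)"
  have h: "h = 0 \<or> degree h < s - k"
  proof (cases "s - k = 0")
    case False
    have "degree h \<le> s - k - 1"
      unfolding h_def by (intro degree_sum_le) (auto intro: order.trans[OF degree_monom_le])
    then show ?thesis using False by linarith
  qed (simp add: h_def)
  then have d: "locator k * h = 0 \<or> degree (locator k * h) < s"
    using k by (cases "h = 0") (auto simp: degree_mult_eq locator_nonzero degree_locator)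
  have "p dvd (\<Sum>j<s. (generator_mat k *\<^sub>v c) $ j * \<alpha> ^ (j * i))" if i: "i < k" for i
  proof -
    have "(\<Sum>j<s. (generator_mat k *\<^sub>v c) $ j * \<alpha> ^ (j * i)) =
       (\<Sum>j<s. (if j < k then p * c $ j else 0) * \<alpha> ^ (j * i)) +
       (\<Sum>j<s. coeff (locator k * h) j * (\<alpha> ^ i) ^ j)"
      using c k by (simp add: coeff_mult_vec_generator_mat h_def sum.distrib[symmetric]
          algebra_simps power_mult[symmetric])
    also have "(\<Sum>j<s. coeff (locator k * h) j * (\<alpha> ^ i) ^ j) = poly (locator k * h) (\<alpha> ^ i)"
      by (rule poly_eq_sum_lessThan[OF d, symmetric])
    also have "\<dots> = 0" using locator_root[OF i] by simp
    finally show ?thesis by (auto intro!: dvd_sum)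
  qed
  then show ?thesis by (simp add: code_def)
qed

text \<open>Divide by the locator; the remainder vanishes at more points modulo \<open>p\<close> than its degree.\<close>

lemma code_spanned:
  assumes a: "a \<in> code k" and k: "k \<le> s"
  obtains c where "c \<in> carrier_vec s" "\<And>i. i < s \<Longrightarrow> a i = (generator_mat k *\<^sub>v c) $ i"
proof -
  define f where "f = (\<Sum>j<s. monom (a j) j)"
  have coeff_f: "coeff f i = (if i < s then a i else 0)" for i
    by (simp add: f_def coeff_sum)
  have f: "f = 0 \<or> degree f < s"
    using coeff_f[of "degree f"] by (metis leading_coeff_0_iff)
  \<comment> \<open>The locator is monic, so pseudo-division is a true division over the
    integers.\<close>
  obtain q r where qr: "pseudo_divmod f (locator k) = (q, r)" by fastforce
  have fqr: "f = locator k * q + r" and r: "r = 0 \<or> degree r < k"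
    using pseudo_divmod[OF locator_nonzero qr] locator_monic[of k] degree_locator[of k] by auto
  have q: "q = 0 \<or> degree q < s - k"
  proof (rule ccontr)
    assume "\<not> ?thesis"
    then have q: "q \<noteq> 0" "degree q \<ge> s - k" by auto
    then have dq: "degree (locator k * q) = k + degree q"
      by (simp add: degree_mult_eq locator_nonzero degree_locator)
    have "coeff (locator k * q) (k + degree q) \<noteq> 0"
      using q dq locator_nonzero[of k] by (metis leading_coeff_0_iff mult_eq_0_iff)
    moreover have "coeff r (k + degree q) = 0"
      using r by (auto simp: coeff_eq_0)
    ultimately have "coeff f (k + degree q) \<noteq> 0" using fqr by simp
    with coeff_f q k show False by (auto split: if_splits)
  qed
  have "p dvd coeff r l" for l
  proof (rule prime_dvd_coeffs_of_roots[OF p r, of "\<lambda>i. \<alpha> ^ i"])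
    fix i assume i: "i < k"
    have "poly r (\<alpha> ^ i) = poly f (\<alpha> ^ i)" using fqr locator_root[OF i] by simp
    also have "\<dots> = (\<Sum>j<s. a j * \<alpha> ^ (j * i))"
      using f by (simp add: poly_eq_sum_lessThan coeff_f power_mult[symmetric] mult.commute)
    finally show "p dvd poly r (\<alpha> ^ i)" using a i by (simp add: code_def)
  next
    show "\<not> p dvd \<alpha> ^ j - \<alpha> ^ i" if "i < j" "j < k" for i j
      using that k not_cong_powers by simp
  qed
  then obtain b where b: "\<And>l. coeff r l = p * b l" unfolding dvd_def by metis
  \<comment> \<open>The order follows the columns of the generator matrix: first the remainder
    divided by \<open>p\<close>, then the quotient.\<close>
  define c where "c = vec s (\<lambda>j. if j < k then b j else coeff q (j - k))"
  have c: "c \<in> carrier_vec s" by (simp add: c_def)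
  have qsum: "(\<Sum>j<s - k. monom (c $ (j + k)) j) = q"
  proof (rule poly_eqI)
    fix n
    have "coeff (\<Sum>j<s - k. monom (c $ (j + k)) j) n = (if n < s - k then coeff q n else 0)"
      by (auto simp: coeff_sum c_def)
    then show "coeff (\<Sum>j<s - k. monom (c $ (j + k)) j) n = coeff q n"
      using q by (auto simp: coeff_eq_0)
  qed
  have "a i = (generator_mat k *\<^sub>v c) $ i" if "i < s" for i
  proof -
    have "a i = coeff r i + coeff (locator k * q) i" using coeff_f[of i] that fqr by simp
    also have "coeff r i = (if i < k then p * c $ i else 0)"
    proof (cases "i < k")
      case False
      then have "coeff r i = 0" using r by (auto simp: coeff_eq_0)
      then show ?thesis using False by simp
    qed (use b that in \<open>simp add: c_def\<close>)
    finally show ?thesis using coeff_mult_vec_generator_mat[OF c k that] qsum by simp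
  qed
  with c that show ?thesis by blast
qed

section \<open>Orthogonality of the powers of \<alpha> and the minimum of the quadratic form\<close>

lemma power_sum_dvd:
  assumes "\<not> s dvd n"
  shows "p dvd (\<Sum>i<s. (\<alpha> ^ n) ^ i)"
proof -
  \<comment> \<open>The geometric sum telescopes to a multiple of \<open>p\<close>, whereas the
    factor in front is prime to \<open>p\<close>.\<close>
  have "(\<alpha> ^ n - 1) * (\<Sum>i<s. (\<alpha> ^ n) ^ i) = \<alpha> ^ (n * s) - 1"
    by (metis power_diff_1_eq power_mult)
  moreover have "[\<alpha> ^ (n * s) = \<alpha> ^ 0] (mod p)"
    by (subst power_cong_iff) (simp add: cong_0_iff)
  ultimately have "p dvd (\<alpha> ^ n - 1) * (\<Sum>i<s. (\<alpha> ^ n) ^ i)"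
    by (simp add: cong_iff_dvd_diff)
  moreover have "\<not> p dvd \<alpha> ^ n - 1"
    using power_cong_iff[of n 0] assms by (simp add: cong_iff_dvd_diff cong_0_iff)
  ultimately show ?thesis using p prime_dvd_mult_iff by blast
qed

text \<open>Expanding the product and summing over \<open>i\<close> first leaves only the diagonal
  terms. The exponent \<open>s - i\<close> plays the role of \<open>- i\<close>, as exponents matter
  modulo \<open>s\<close> only.\<close>

lemma parseval_mod:
  "[(\<Sum>i<s. (\<Sum>j<s. a j * \<alpha> ^ (j * i)) * (\<Sum>j<s. a j * \<alpha> ^ (j * (s - i)))) = int s * (\<Sum>j<s. (a j)\<^sup>2)] (mod p)"
proof -
  \<comment> \<open>Modulo \<open>s\<close>, the exponent \<open>j + l * (s - 1)\<close> is the
    difference of \<open>j\<close> and \<open>l\<close>, written without subtracting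
    \<open>l\<close>.\<close>
  have pw: "[\<alpha> ^ (j * i) * \<alpha> ^ (l * (s - i)) = (\<alpha> ^ (j + l * (s - 1))) ^ i] (mod p)" if "i < s" for i j l
  proof -
    have "[j * i + l * (s - i) = (j + l * (s - 1)) * i] (mod s)"
    proof -
      have "int (j * i + l * (s - i)) - int ((j + l * (s - 1)) * i) = int s * (int l * (1 - int i))"
      proof -
        have "int (s - i) = int s - int i" "int (s - 1) = int s - 1"
          using that by (auto simp: of_nat_diff)
        then show ?thesis by (simp only: of_nat_add of_nat_mult) (simp add: algebra_simps)
      qed
      then have "[int (j * i + l * (s - i)) = int ((j + l * (s - 1)) * i)] (mod int s)"
        by (metis cong_iff_dvd_diff dvd_triv_left)
      then show ?thesis by (simp only: cong_int_iff)
    qed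
    then show ?thesis by (simp only: power_add[symmetric] power_mult[symmetric] power_cong_iff)
  qed
  have inner: "[(\<Sum>i<s. (\<alpha> ^ (j + l * (s - 1))) ^ i) = (if j = l then int s else 0)] (mod p)"
    if "j < s" "l < s" for j l
  proof -
    have "int (j + l * (s - 1)) = (int j - int l) + int s * int l"
    proof -
      have "int (s - 1) = int s - 1" using s by (simp add: of_nat_diff)
      then show ?thesis by (simp only: of_nat_add of_nat_mult) (simp add: algebra_simps)
    qed
    then have "int s dvd int (j + l * (s - 1)) \<longleftrightarrow> int s dvd int j - int l"
      by (metis dvd_add_times_triv_right_iff mult.commute)
    also have "\<dots> \<longleftrightarrow> [j = l] (mod s)" by (metis cong_iff_dvd_diff cong_int_iff)
    also have "\<dots> \<longleftrightarrow> j = l" using that by (simp add: cong_def)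
    finally have iff: "s dvd j + l * (s - 1) \<longleftrightarrow> j = l" by (simp only: int_dvd_int_iff)
    show ?thesis
    proof (cases "j = l")
      case True
      then have "[\<alpha> ^ (j + l * (s - 1)) = \<alpha> ^ 0] (mod p)"
        using iff by (subst power_cong_iff) (simp add: cong_0_iff)
      then have "[(\<Sum>i<s. (\<alpha> ^ (j + l * (s - 1))) ^ i) = (\<Sum>i<s. 1 ^ i)] (mod p)"
        by (intro cong_sum cong_pow) simp
      then show ?thesis using True by simp
    next
      case False
      then show ?thesis using power_sum_dvd iff by (simp add: cong_0_iff)
    qed
  qed
  have "(\<Sum>i<s. (\<Sum>j<s. a j * \<alpha> ^ (j * i)) * (\<Sum>l<s. a l * \<alpha> ^ (l * (s - i)))) =
     (\<Sum>i<s. \<Sum>j<s. \<Sum>l<s. (a j * a l) * (\<alpha> ^ (j * i) * \<alpha> ^ (l * (s - i))))"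
    by (simp add: sum_product algebra_simps)
  also have "[\<dots> = (\<Sum>i<s. \<Sum>j<s. \<Sum>l<s. (a j * a l) * (\<alpha> ^ (j + l * (s - 1))) ^ i)] (mod p)"
    by (intro cong_sum cong_mult cong_refl pw) auto
  also have "(\<Sum>i<s. \<Sum>j<s. \<Sum>l<s. (a j * a l) * (\<alpha> ^ (j + l * (s - 1))) ^ i) =
     (\<Sum>j<s. \<Sum>i<s. \<Sum>l<s. (a j * a l) * (\<alpha> ^ (j + l * (s - 1))) ^ i)"
    by (rule sum.swap)
  also have "\<dots> = (\<Sum>j<s. \<Sum>l<s. \<Sum>i<s. (a j * a l) * (\<alpha> ^ (j + l * (s - 1))) ^ i)"
    by (intro sum.cong refl sum.swap)
  also have "\<dots> = (\<Sum>j<s. \<Sum>l<s. (a j * a l) * (\<Sum>i<s. (\<alpha> ^ (j + l * (s - 1))) ^ i))"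
    by (simp only: sum_distrib_left)
  also have "[\<dots> = (\<Sum>j<s. \<Sum>l<s. (a j * a l) * (if j = l then int s else 0))] (mod p)"
    by (intro cong_sum cong_mult cong_refl inner) auto
  also have "(\<Sum>j<s. \<Sum>l<s. (a j * a l) * (if j = l then int s else 0)) = int s * (\<Sum>j<s. (a j)\<^sup>2)"
    by (simp add: sum_distrib_left power2_eq_square mult.commute if_distrib cong: if_cong)
  finally show ?thesis .
qed

text \<open>For every \<open>i\<close>, one of \<open>i\<close> and \<open>s - i\<close> is below
  \<open>k\<close>, so each term of Parseval's identity has a factor divisible by
  \<open>p\<close>.\<close>

lemma code_sum_squares:
  assumes a: "a \<in> code k" and k: "s \<le> 2 * (k - 1)" and ps: "\<not> p dvd int s"
  shows "p dvd (\<Sum>j<s. (a j)\<^sup>2)"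
proof -
  have "p dvd (\<Sum>j<s. a j * \<alpha> ^ (j * i)) * (\<Sum>j<s. a j * \<alpha> ^ (j * (s - i)))" for i
  proof -
    have "i < k \<or> s - i < k" using k s by linarith
    then show ?thesis using a by (auto simp: code_def)
  qed
  then have "p dvd int s * (\<Sum>j<s. (a j)\<^sup>2)"
    using parseval_mod[of a] by (meson cong_dvd_iff dvd_sum)
  then show ?thesis using ps p prime_dvd_mult_iff by blast
qed

text \<open>The form is positive by the Cauchy-Schwarz inequality, as \<open>m s < p\<close>; it is even, and on the
  code it is divisible by \<open>p\<^sup>2\<close>.\<close>

lemma code_form_lower_bound:
  assumes a: "a \<in> code k" and k: "s \<le> 2 * (k - 1)" and m: "m * int s = p - 1" "odd m" and "odd p"
    and nz: "j < s" "a j \<noteq> 0"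
  shows "2 * p\<^sup>2 \<le> p * (\<Sum>j<s. (a j)\<^sup>2) - m * (\<Sum>j<s. a j)\<^sup>2"
proof -
  let ?S = "\<Sum>j<s. a j" and ?T = "\<Sum>j<s. (a j)\<^sup>2"
  let ?Q = "p * ?T - m * ?S\<^sup>2"
  have p1: "p > 1" using p by (simp add: prime_gt_1_int)
  have m0: "m > 0" using m(1) p1 s by (metis diff_gt_0_iff_gt of_nat_0_less_iff zero_less_mult_pos2)
  have ps: "\<not> p dvd int s"
  proof
    assume "p dvd int s"
    then have "p dvd p - (p - 1)" using m(1) by (metis dvd_diff dvd_mult dvd_refl)
    then show False using p1 by auto
  qed
  have "p dvd ?S"
  proof -
    have "0 < k" using k s by linarith
    then show ?thesis using a unfolding code_def by force
  qed
  moreover have "p dvd ?T" using code_sum_squares[OF a k ps] .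
  ultimately have pQ: "p\<^sup>2 dvd ?Q"
    by (metis dvd_diff dvd_mult dvd_power_same mult_dvd_mono dvd_refl power2_eq_square)
  \<comment> \<open>Each square has the parity of its base, so \<open>?T\<close> and
    \<open>?S\<close> agree modulo 2; as \<open>p\<close> and \<open>m\<close> are odd,
    \<open>?Q\<close> is even.\<close>
  have "even (?T - ?S)"
    by (subst sum_subtractf[symmetric]) (auto intro!: dvd_sum simp: power2_eq_square)
  then have "even ?Q" using m(2) \<open>odd p\<close> by simp
  moreover have "coprime 2 (p\<^sup>2)" using \<open>odd p\<close> by simp
  ultimately have "2 * p\<^sup>2 dvd ?Q" using pQ by (simp add: divides_mult)
  moreover have "?Q > 0"
  proof -
    have "?S\<^sup>2 \<le> int s * ?T"
      using square_sum_le_card_sum_squares[of a "{..<s}"] by simp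
    then have "m * ?S\<^sup>2 \<le> (p - 1) * ?T"
      using m0 mult_left_mono[of "?S\<^sup>2" "int s * ?T" m] by (simp add: m(1)[symmetric] mult.assoc)
    moreover have "?T > 0"
      using nz by (intro sum_pos2[of _ j]) auto
    ultimately show ?thesis by (simp add: algebra_simps)
  qed
  ultimately show ?thesis by (rule zdvd_imp_le)
qed

end

section \<open>Subfields of the complex numbers and roots of unity\<close>

lemma complex_subfield_zero: "complex_subfield K \<Longrightarrow> 0 \<in> K"
  unfolding complex_subfield_def by (metis cancel_comm_monoid_add_class.diff_cancel)

lemma complex_subfield_one: "complex_subfield K \<Longrightarrow> 1 \<in> K"
  unfolding complex_subfield_def by blast

lemma complex_subfield_diff: "complex_subfield K \<Longrightarrow> x \<in> K \<Longrightarrow> y \<in> K \<Longrightarrow> x - y \<in> K"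
  unfolding complex_subfield_def by blast

lemma complex_subfield_uminus: "complex_subfield K \<Longrightarrow> x \<in> K \<Longrightarrow> - x \<in> K"
  using complex_subfield_diff[of K 0 x] complex_subfield_zero by simp

lemma complex_subfield_add: "complex_subfield K \<Longrightarrow> x \<in> K \<Longrightarrow> y \<in> K \<Longrightarrow> x + y \<in> K"
  using complex_subfield_diff[of K x "- y"] complex_subfield_uminus by simp

lemma complex_subfield_mult: "complex_subfield K \<Longrightarrow> x \<in> K \<Longrightarrow> y \<in> K \<Longrightarrow> x * y \<in> K"
  unfolding complex_subfield_def by blast

lemma complex_subfield_inverse: "complex_subfield K \<Longrightarrow> x \<in> K \<Longrightarrow> inverse x \<in> K"
  unfolding complex_subfield_def by blast

lemma complex_subfield_divide: "complex_subfield K \<Longrightarrow> x \<in> K \<Longrightarrow> y \<in> K \<Longrightarrow> x / y \<in> K"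
  unfolding divide_inverse by (intro complex_subfield_mult complex_subfield_inverse)

lemma complex_subfield_sum:
  "complex_subfield K \<Longrightarrow> (\<And>i. i \<in> I \<Longrightarrow> f i \<in> K) \<Longrightarrow> sum f I \<in> K"
  by (induction I rule: infinite_finite_induct) (auto intro: complex_subfield_zero complex_subfield_add)

lemma complex_subfield_prod:
  "complex_subfield K \<Longrightarrow> (\<And>i. i \<in> I \<Longrightarrow> f i \<in> K) \<Longrightarrow> prod f I \<in> K"
  by (induction I rule: infinite_finite_induct) (auto intro: complex_subfield_one complex_subfield_mult)

lemma complex_subfield_power: "complex_subfield K \<Longrightarrow> x \<in> K \<Longrightarrow> x ^ n \<in> K"
  by (induction n) (auto intro: complex_subfield_one complex_subfield_mult)

lemma complex_subfield_of_nat: "complex_subfield K \<Longrightarrow> of_nat n \<in> K"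
  by (induction n) (auto intro: complex_subfield_zero complex_subfield_one complex_subfield_add)

lemma complex_subfield_of_int: "complex_subfield K \<Longrightarrow> of_int n \<in> K"
  by (cases n rule: int_cases2) (auto intro: complex_subfield_of_nat complex_subfield_uminus)

lemma complex_subfield_of_rat: "complex_subfield K \<Longrightarrow> of_rat q \<in> K"
  by (cases q) (auto simp: of_rat_rat intro!: complex_subfield_divide complex_subfield_of_int)

lemma complex_subfield_Inter: "(\<And>K. K \<in> \<K> \<Longrightarrow> complex_subfield K) \<Longrightarrow> complex_subfield (\<Inter>\<K>)"
  unfolding complex_subfield_def by blast

lemma complex_subfield_rat_adjoin: "complex_subfield (rat_adjoin z)"
  unfolding rat_adjoin_def by (rule hull_in) (simp add: complex_subfield_Inter)

lemma rat_adjoin_self: "z \<in> rat_adjoin z"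
  unfolding rat_adjoin_def by (rule hull_inc) simp

lemma rat_adjoin_minimal: "complex_subfield K \<Longrightarrow> z \<in> K \<Longrightarrow> rat_adjoin z \<subseteq> K"
  unfolding rat_adjoin_def by (intro hull_minimal) auto

text \<open>The extensionality demanded in \<open>embeddings\<close> is dropped, because the
  iterates of an automorphism, beginning with the identity, need not have it.\<close>

definition field_hom :: "complex set \<Rightarrow> (complex \<Rightarrow> complex) \<Rightarrow> bool" where
  "field_hom K f \<longleftrightarrow> f 1 = 1 \<and> (\<forall>x\<in>K. \<forall>y\<in>K. f (x + y) = f x + f y) \<and>
     (\<forall>x\<in>K. \<forall>y\<in>K. f (x * y) = f x * f y)"

lemma embeddings_iff_field_hom: "f \<in> embeddings K \<longleftrightarrow> f \<in> extensional K \<and> field_hom K f"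
  by (auto simp: embeddings_def field_hom_def)

locale subfield_hom =
  fixes K f
  assumes K: "complex_subfield K" and f: "field_hom K f"
begin

lemma hom_one: "f 1 = 1" using f by (simp add: field_hom_def)

lemma hom_add: "x \<in> K \<Longrightarrow> y \<in> K \<Longrightarrow> f (x + y) = f x + f y" using f by (simp add: field_hom_def)

lemma hom_mult: "x \<in> K \<Longrightarrow> y \<in> K \<Longrightarrow> f (x * y) = f x * f y" using f by (simp add: field_hom_def)

lemma hom_zero: "f 0 = 0" using hom_add[of 0 0] complex_subfield_zero[OF K] by simp

lemma hom_uminus: "x \<in> K \<Longrightarrow> f (- x) = - f x"
  using hom_add[of x "- x"] complex_subfield_uminus[OF K, of x] hom_zero
  by (simp add: eq_neg_iff_add_eq_0 add.commute)

lemma hom_diff: "x \<in> K \<Longrightarrow> y \<in> K \<Longrightarrow> f (x - y) = f x - f y"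
  using hom_add[of x "- y"] hom_uminus complex_subfield_uminus[OF K, of y] by simp

lemma hom_inverse: "x \<in> K \<Longrightarrow> f (inverse x) = inverse (f x)"
  using hom_mult[of x "inverse x"] complex_subfield_inverse[OF K] hom_one hom_zero
  by (cases "x = 0") (auto simp: inverse_unique)

lemma hom_eq_zero_iff: "x \<in> K \<Longrightarrow> f x = 0 \<longleftrightarrow> x = 0"
  using hom_mult[of x "inverse x"] complex_subfield_inverse[OF K] hom_one hom_zero
  by (cases "x = 0") auto

lemma hom_inj: "x \<in> K \<Longrightarrow> y \<in> K \<Longrightarrow> f x = f y \<longleftrightarrow> x = y"
  using hom_eq_zero_iff[of "x - y"] hom_diff complex_subfield_diff[OF K] by auto

lemma hom_sum: "(\<And>i. i \<in> I \<Longrightarrow> g i \<in> K) \<Longrightarrow> f (sum g I) = (\<Sum>i\<in>I. f (g i))"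
  by (induction I rule: infinite_finite_induct)
    (auto simp: hom_zero hom_add complex_subfield_sum[OF K])

lemma hom_prod: "(\<And>i. i \<in> I \<Longrightarrow> g i \<in> K) \<Longrightarrow> f (prod g I) = (\<Prod>i\<in>I. f (g i))"
  by (induction I rule: infinite_finite_induct)
    (auto simp: hom_one hom_mult complex_subfield_prod[OF K])

lemma hom_power: "x \<in> K \<Longrightarrow> f (x ^ n) = f x ^ n"
  by (induction n) (auto simp: hom_one hom_mult complex_subfield_power[OF K])

lemma hom_of_nat: "f (of_nat n) = of_nat n"
  by (induction n) (auto simp: hom_zero hom_one hom_add complex_subfield_one[OF K] complex_subfield_of_nat[OF K])

lemma hom_of_int: "f (of_int n) = of_int n"
  by (cases n rule: int_cases2) (auto simp: hom_of_nat hom_uminus complex_subfield_of_nat[OF K])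

lemma hom_of_rat: "f (of_rat q) = of_rat q"
  by (cases q) (auto simp: of_rat_rat divide_inverse hom_mult hom_inverse hom_of_int
      complex_subfield_inverse[OF K] complex_subfield_of_int[OF K])

end

text \<open>The points where two homomorphisms agree form a subfield, so minimality of
  \<open>rat_adjoin z\<close> applies.\<close>

lemma field_hom_eq_on_rat_adjoin:
  assumes "field_hom (rat_adjoin z) f" "field_hom (rat_adjoin z) g" "f z = g z"
    and x: "x \<in> rat_adjoin z"
  shows "f x = g x"
proof -
  interpret f: subfield_hom "rat_adjoin z" f
    using assms complex_subfield_rat_adjoin by unfold_locales
  interpret g: subfield_hom "rat_adjoin z" g
    using assms complex_subfield_rat_adjoin by unfold_locales
  let ?E = "{x \<in> rat_adjoin z. f x = g x}"
  have "complex_subfield ?E"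
    unfolding complex_subfield_def using f.K
    by (auto simp: f.hom_one g.hom_one f.hom_diff g.hom_diff f.hom_mult g.hom_mult
        f.hom_inverse g.hom_inverse complex_subfield_one complex_subfield_diff
        complex_subfield_mult complex_subfield_inverse)
  then have "rat_adjoin z \<subseteq> ?E"
    using assms(3) rat_adjoin_self by (intro rat_adjoin_minimal) auto
  then show ?thesis using x by blast
qed

text \<open>The scalar multiplication is the one in \<open>degree_over_rat\<close>, so spans and
  dimensions from the library apply to that degree.\<close>

global_interpretation rat_complex: vector_space "\<lambda>(q :: rat) (z :: complex). of_rat q * z"
  by unfold_locales (simp_all add: algebra_simps of_rat_add of_rat_mult)

lemma complex_subfield_subspace: "complex_subfield K \<Longrightarrow> rat_complex.subspace K"
  by (intro rat_complex.subspaceI)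
    (auto intro: complex_subfield_zero complex_subfield_add complex_subfield_mult complex_subfield_of_rat)

lemma primitive_root_of_unity_power_eq_1_iff:
  assumes z: "primitive_root_of_unity n z" and n: "n > 0"
  shows "z ^ k = 1 \<longleftrightarrow> n dvd k"
proof -
  have "z ^ k = z ^ (n * (k div n) + k mod n)" by simp
  also have "\<dots> = z ^ (k mod n)"
    using z by (simp only: power_add power_mult) (simp add: primitive_root_of_unity_def)
  finally have "z ^ k = z ^ (k mod n)" .
  then show ?thesis
    using z n by (cases "k mod n = 0")
      (auto simp: primitive_root_of_unity_def dvd_eq_mod_eq_0)
qed

section \<open>Powers of a primitive root of unity of prime order\<close>

locale cyclotomic =
  fixes p r :: nat and \<zeta> :: complex and S :: "complex \<Rightarrow> complex"
  assumes p: "prime p" and \<zeta>: "primitive_root_of_unity p \<zeta>" and r: "residue_primroot p r"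
    and S_aut: "S \<in> field_automorphisms (rat_adjoin \<zeta>)" and S_\<zeta>: "S \<zeta> = \<zeta> ^ r"
begin

abbreviation "L \<equiv> rat_adjoin \<zeta>"

text \<open>The roots of unity other than 1 are indexed by discrete logarithms to the base
  \<open>r\<close>. The automorphism \<open>S\<close> then acts as the shift of the index by one,
  and indices matter only modulo \<open>p - 1\<close>.\<close>

definition \<omega> :: "nat \<Rightarrow> complex" where "\<omega> i = \<zeta> ^ (r ^ i)"

lemma p_gt_1: "p > 1" using p by (rule prime_gt_1_nat)

lemma L: "complex_subfield L" by (rule complex_subfield_rat_adjoin)

lemma \<zeta>_power_eq_1_iff: "\<zeta> ^ k = 1 \<longleftrightarrow> p dvd k"
  using primitive_root_of_unity_power_eq_1_iff[OF \<zeta>] p_gt_1 by simp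

lemma \<zeta>_nonzero: "\<zeta> \<noteq> 0"
  using \<zeta>_power_eq_1_iff[of p] p_gt_1 by (auto simp: power_0_left)

lemma \<zeta>_power_mod: "\<zeta> ^ (k mod p) = \<zeta> ^ k"
proof -
  have "\<zeta> ^ k = \<zeta> ^ (p * (k div p) + k mod p)" by simp
  also have "\<dots> = \<zeta> ^ (k mod p)"
    using \<zeta>_power_eq_1_iff[of p] by (simp only: power_add power_mult) simp
  finally show ?thesis by simp
qed

lemma \<zeta>_power_cong: "[k = l] (mod p) \<Longrightarrow> \<zeta> ^ k = \<zeta> ^ l"
  by (metis \<zeta>_power_mod cong_def)

lemma r_power_cong_iff: "[r ^ i = r ^ j] (mod p) \<longleftrightarrow> [i = j] (mod (p - 1))"
  using r p by (simp add: order_divides_expdiff residue_primroot_def totient_prime)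

lemma \<omega>_cong: "[i = j] (mod (p - 1)) \<Longrightarrow> \<omega> i = \<omega> j"
  unfolding \<omega>_def using r_power_cong_iff \<zeta>_power_cong by blast

lemma \<omega>_period [simp]: "\<omega> (i + (p - 1)) = \<omega> i"
  by (rule \<omega>_cong) (simp add: cong_def)

lemma \<omega>_in_L: "\<omega> i \<in> L"
  unfolding \<omega>_def by (intro complex_subfield_power L rat_adjoin_self)

lemma \<omega>_0: "\<omega> 0 = \<zeta>" by (simp add: \<omega>_def)

lemma bij_r: "bij_betw (\<lambda>i. r ^ i mod p) {..<p - 1} {0<..<p}"
  using residue_primroot_is_generator[OF _ r] p p_gt_1
  by (simp add: totient_prime totatives_prime)

lemma \<zeta>_power_eq_\<omega>:
  assumes "\<not> p dvd k"
  obtains i where "i < p - 1" "\<zeta> ^ k = \<omega> i"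
proof -
  have "k mod p \<in> {0<..<p}" using assms p_gt_1 by (auto simp: dvd_eq_mod_eq_0)
  then have "k mod p \<in> (\<lambda>i. r ^ i mod p) ` {..<p - 1}"
    by (simp only: bij_betw_imp_surj_on[OF bij_r])
  then obtain i where i: "i < p - 1" "r ^ i mod p = k mod p" by auto
  then have "\<zeta> ^ k = \<omega> i" unfolding \<omega>_def by (intro \<zeta>_power_cong) (simp add: cong_def)
  then show ?thesis using i(1) that by blast
qed

text \<open>The exponents run through all nonzero residues, so this is a full geometric sum of
  length \<open>p\<close> without its term 1.\<close>

lemma sum_\<omega>_power:
  "(\<Sum>i<p - 1. \<omega> i ^ n) = (if p dvd n then of_nat p - 1 else - 1)"
proof -
  have "(\<Sum>i<p - 1. \<omega> i ^ n) = (\<Sum>i<p - 1. (\<zeta> ^ n) ^ (r ^ i mod p))"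
  proof (rule sum.cong)
    fix i
    have "\<omega> i ^ n = (\<zeta> ^ (r ^ i mod p)) ^ n" by (simp add: \<omega>_def \<zeta>_power_mod)
    then show "\<omega> i ^ n = (\<zeta> ^ n) ^ (r ^ i mod p)" by (metis mult.commute power_mult)
  qed simp
  also have "\<dots> = (\<Sum>c\<in>{0<..<p}. (\<zeta> ^ n) ^ c)"
    by (rule sum.reindex_bij_betw[OF bij_r])
  also have "{0<..<p} = {..<p} - {0}" by auto
  also have "(\<Sum>c\<in>{..<p} - {0}. (\<zeta> ^ n) ^ c) = (\<Sum>c<p. (\<zeta> ^ n) ^ c) - 1"
    using p_gt_1 by (subst sum_diff1) auto
  also have "(\<Sum>c<p. (\<zeta> ^ n) ^ c) = (if p dvd n then of_nat p else 0)"
  proof (cases "p dvd n")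
    case True
    then show ?thesis using \<zeta>_power_eq_1_iff[of n] by simp
  next
    case False
    have "(\<zeta> ^ n - 1) * (\<Sum>c<p. (\<zeta> ^ n) ^ c) = (\<zeta> ^ n) ^ p - 1"
      by (simp add: power_diff_1_eq)
    also have "(\<zeta> ^ n) ^ p = 1" by (simp add: power_mult[symmetric] \<zeta>_power_eq_1_iff)
    finally show ?thesis using False \<zeta>_power_eq_1_iff[of n] by simp
  qed
  finally show ?thesis by auto
qed

lemma sum_\<omega>: "(\<Sum>i<p - 1. \<omega> i) = - 1"
  using sum_\<omega>_power[of 1] p_gt_1 by simp

lemma sum_\<omega>_shift: "(\<Sum>k<p - 1. \<omega> (j + k)) = - 1"
proof -
  have "\<omega> (j + k) = \<omega> k ^ (r ^ j)" for k
    by (simp add: \<omega>_def power_mult[symmetric] power_add mult.commute)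
  then show ?thesis using sum_\<omega>_power[of "r ^ j"] r p
    by (auto simp: residue_primroot_def coprime_power_right_iff prime_dvd_power_iff
        dest: coprime_absorb_left coprime_common_divisor_nat prime_dvd_power)
qed

lemma cnj_\<zeta>: "cnj \<zeta> = \<zeta> ^ (p - 1)"
proof -
  have "norm \<zeta> = 1" using power_eq_1_iff[of \<zeta> p] \<zeta>_power_eq_1_iff[of p] p_gt_1 by simp
  then have "\<zeta> * cnj \<zeta> = 1" by (metis complex_norm_square of_real_1 one_power2)
  moreover have "\<zeta> * \<zeta> ^ (p - 1) = 1"
    using \<zeta>_power_eq_1_iff[of p] p_gt_1 by (simp add: power_eq_if)
  ultimately show ?thesis using \<zeta>_nonzero by (metis mult_left_cancel)
qed

text \<open>Conjugation is the power \<open>p - 1\<close> on roots of unity. Each summand is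
  therefore a power of \<open>\<omega> k\<close> with an exponent congruent to
  \<open>r ^ i - r ^ j\<close> modulo \<open>p\<close>, and \<open>sum_\<omega>_power\<close>
  applies.\<close>

lemma \<omega>_orthogonality:
  "(\<Sum>k<p - 1. \<omega> (i + k) * cnj (\<omega> (j + k))) = (if [i = j] (mod (p - 1)) then of_nat p else 0) - 1"
proof -
  have "\<omega> (i + k) * cnj (\<omega> (j + k)) = \<omega> k ^ (r ^ i + (p - 1) * r ^ j)" for k
    by (simp add: \<omega>_def cnj_\<zeta> power_mult[symmetric] power_add[symmetric] algebra_simps)
  then have "(\<Sum>k<p - 1. \<omega> (i + k) * cnj (\<omega> (j + k))) =
      (if p dvd r ^ i + (p - 1) * r ^ j then of_nat p - 1 else - 1)"
    using sum_\<omega>_power by simp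
  moreover have "p dvd r ^ i + (p - 1) * r ^ j \<longleftrightarrow> [i = j] (mod (p - 1))"
  proof -
    have "int (r ^ i + (p - 1) * r ^ j) = (int (r ^ i) - int (r ^ j)) + int p * int (r ^ j)"
    proof -
      have "int (p - 1) = int p - 1" using p_gt_1 by (simp add: of_nat_diff)
      then show ?thesis by (simp only: of_nat_add of_nat_mult) (simp add: algebra_simps)
    qed
    then have "int p dvd int (r ^ i + (p - 1) * r ^ j) \<longleftrightarrow> int p dvd int (r ^ i) - int (r ^ j)"
      by (metis dvd_add_times_triv_right_iff mult.commute)
    also have "\<dots> \<longleftrightarrow> [r ^ i = r ^ j] (mod p)" by (metis cong_iff_dvd_diff cong_int_iff)
    finally show ?thesis using r_power_cong_iff by (simp only: int_dvd_int_iff)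
  qed
  ultimately show ?thesis by simp
qed

text \<open>The power of \<open>r\<close> with exponent \<open>(p - 1) div 2\<close> squares to 1
  modulo \<open>p\<close> but is not 1, so it is -1, and shifting the index by this exponent inverts
  the root of unity.\<close>

lemma cnj_\<omega>: "even (p - 1) \<Longrightarrow> cnj (\<omega> i) = \<omega> (i + (p - 1) div 2)"
proof -
  assume ev: "even (p - 1)"
  let ?h = "(p - 1) div 2"
  have "?h + ?h = p - 1" using ev by presburger
  then have "[?h + ?h = 0] (mod (p - 1))" by (simp add: cong_0_iff)
  then have "[r ^ (?h + ?h) = 1] (mod p)"
    by (metis r_power_cong_iff power_0)
  then have "[int (r ^ ?h) * int (r ^ ?h) = 1] (mod int p)"
    by (metis cong_int_iff of_nat_mult of_nat_1 power_add)
  then have "int p dvd (int (r ^ ?h) - 1) * (int (r ^ ?h) + 1)"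
    by (simp add: cong_iff_dvd_diff algebra_simps)
  moreover have "\<not> int p dvd int (r ^ ?h) - 1"
  proof
    assume "int p dvd int (r ^ ?h) - 1"
    then have "[r ^ ?h = r ^ 0] (mod p)" by (metis cong_iff_dvd_diff cong_int_iff of_nat_1 power_0)
    then have "[?h = 0] (mod (p - 1))" using r_power_cong_iff by blast
    moreover have "?h < p - 1" "?h \<noteq> 0" using p_gt_1 \<open>?h + ?h = p - 1\<close> by linarith+
    ultimately show False by (simp add: cong_def)
  qed
  ultimately have "int p dvd int (r ^ ?h) + 1"
    using p prime_dvd_mult_iff[of "int p"] by auto
  then have "p dvd r ^ ?h + 1" by (metis int_dvd_int_iff of_nat_1 of_nat_add)
  then have "p dvd r ^ i * (r ^ ?h + 1)" by (rule dvd_mult)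
  then have "\<zeta> ^ (r ^ (i + ?h)) * \<zeta> ^ (r ^ i) = 1"
    by (simp only: power_add[symmetric] \<zeta>_power_eq_1_iff) (simp add: power_add algebra_simps)
  moreover have "cnj (\<omega> i) * \<zeta> ^ (r ^ i) = 1"
  proof -
    have "cnj (\<omega> i) * \<zeta> ^ (r ^ i) = (\<zeta> ^ p) ^ (r ^ i)"
      using p_gt_1 by (simp add: \<omega>_def cnj_\<zeta> power_mult_distrib[symmetric] power_Suc2[symmetric] del: power_Suc)
    then show ?thesis using \<zeta>_power_eq_1_iff[of p] by simp
  qed
  ultimately have "cnj (\<omega> i) * \<zeta> ^ (r ^ i) = \<omega> (i + ?h) * \<zeta> ^ (r ^ i)" by (simp add: \<omega>_def)
  then show "cnj (\<omega> i) = \<omega> (i + ?h)" using \<zeta>_nonzero by simp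
qed

end

section \<open>The prime cyclotomic field\<close>

text \<open>The number \<open>x\<close> is an eigenvalue of an integer matrix with eigenvector
  \<open>v\<close>, hence a root of the monic integer characteristic polynomial.\<close>

lemma algebraic_int_of_multiplication_matrix:
  fixes x :: complex and A :: "nat \<Rightarrow> nat \<Rightarrow> int"
  assumes eq: "\<And>i. i < n \<Longrightarrow> x * v i = (\<Sum>j<n. of_int (A i j) * v j)"
    and nz: "i < n" "v i \<noteq> 0"
  shows "algebraic_int x"
proof -
  define B :: "int mat" where "B = mat n n (\<lambda>(i, j). A i j)"
  have B: "B \<in> carrier_mat n n" by (simp add: B_def)
  have "map_mat of_int B *\<^sub>v vec n v = x \<cdot>\<^sub>v vec n v"
    by (rule eq_vecI) (auto simp: B_def scalar_prod_def eq lessThan_atLeast0 intro!: sum.cong)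
  moreover have "vec n v \<noteq> 0\<^sub>v n" using nz by (metis index_vec index_zero_vec(1))
  ultimately have "eigenvalue (map_mat of_int B) x"
    using B unfolding eigenvalue_def eigenvector_def by (intro exI[of _ "vec n v"]) auto
  then have "poly (char_poly (map_mat of_int B)) x = 0"
    using B by (subst (asm) eigenvalue_root_char_poly[of _ n]) auto
  then have "poly (map_poly of_int (char_poly B)) x = 0"
    using B by (simp add: of_int_hom.char_poly_hom)
  moreover have "lead_coeff (char_poly B) = 1" using degree_monic_char_poly[OF B] by auto
  ultimately show ?thesis unfolding algebraic_int_altdef_ipoly by blast
qed

global_interpretation int_complex: Modules.module "\<lambda>(n :: int) (z :: complex). of_int n * z"
  by unfold_locales (simp_all add: algebra_simps)

text \<open>Otherwise the simplifier turns \<open>p - 1\<close> into \<open>p - Suc 0\<close> and no fact about \<open>p - 1\<close> matches.\<close>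

declare One_nat_def [simp del]

section \<open>The powers of the automorphism and the span of the conjugates\<close>

context cyclotomic
begin

sublocale S: subfield_hom L S
  using S_aut L by unfold_locales (auto simp: field_automorphisms_def embeddings_iff_field_hom)

lemma S_pow_in_L: "x \<in> L \<Longrightarrow> (S ^^ k) x \<in> L"
  using S_aut by (induction k) (auto simp: field_automorphisms_def)

lemma field_hom_S_pow: "field_hom L (S ^^ k)"
  using S_pow_in_L
  by (induction k) (auto simp: field_hom_def S.hom_one S.hom_add S.hom_mult)

sublocale S_pow: subfield_hom L "S ^^ k" for k
  using field_hom_S_pow L by unfold_locales

lemma S_\<omega>: "S (\<omega> i) = \<omega> (Suc i)"
  unfolding \<omega>_def by (simp add: S.hom_power rat_adjoin_self S_\<zeta> power_mult[symmetric])

lemma S_pow_\<omega>: "(S ^^ k) (\<omega> i) = \<omega> (i + k)"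
  by (induction k) (simp_all add: S_\<omega>)

lemma S_pow_\<zeta>: "(S ^^ k) \<zeta> = \<omega> k"
  using S_pow_\<omega>[of k 0] by (simp add: \<omega>_0)

lemma S_pow_cong: "x \<in> L \<Longrightarrow> [i = j] (mod (p - 1)) \<Longrightarrow> (S ^^ i) x = (S ^^ j) x"
  by (erule field_hom_eq_on_rat_adjoin[OF field_hom_S_pow field_hom_S_pow, rotated])
    (simp add: S_pow_\<zeta> \<omega>_cong)

lemma S_pow_period: "x \<in> L \<Longrightarrow> (S ^^ (p - 1)) x = x"
  using S_pow_cong[of x "p - 1" 0] by (simp add: cong_def)

text \<open>Powers of \<open>S\<close> carry an equality over to all shifts; the orthogonality sums
  \<open>p - 1\<close> and \<open>- 1\<close> would then coincide.\<close>

lemma \<omega>_inj: "i < p - 1 \<Longrightarrow> j < p - 1 \<Longrightarrow> \<omega> i = \<omega> j \<Longrightarrow> i = j"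
proof (rule ccontr)
  assume ij: "i < p - 1" "j < p - 1" "\<omega> i = \<omega> j" "i \<noteq> j"
  then have "\<omega> (i + k) = \<omega> (j + k)" for k by (metis S_pow_\<omega>)
  then have "(\<Sum>k<p - 1. \<omega> (i + k) * cnj (\<omega> (i + k))) = (\<Sum>k<p - 1. \<omega> (i + k) * cnj (\<omega> (j + k)))"
    by simp
  then show False using ij p_gt_1 by (simp add: \<omega>_orthogonality cong_def)
qed

text \<open>The power 1 is minus the sum of all \<open>\<omega> i\<close>; every other power is
  itself one of the \<open>\<omega> i\<close>.\<close>

lemma \<zeta>_power_in_int_span: "\<zeta> ^ k \<in> int_complex.span (\<omega> ` {..<p - 1})"
proof (cases "p dvd k")
  case True
  then have "\<zeta> ^ k = 1" using \<zeta>_power_eq_1_iff by simp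
  then have "\<zeta> ^ k = - (\<Sum>i<p - 1. \<omega> i)" by (simp add: sum_\<omega>)
  moreover have "- (\<Sum>i<p - 1. \<omega> i) \<in> int_complex.span (\<omega> ` {..<p - 1})"
    by (intro int_complex.span_neg int_complex.span_sum int_complex.span_base) simp
  ultimately show ?thesis by simp
next
  case False
  then show ?thesis by (metis \<zeta>_power_eq_\<omega> imageI int_complex.span_base lessThan_iff)
qed

lemma \<omega>_mult_in_int_span: "\<omega> i * \<omega> j \<in> int_complex.span (\<omega> ` {..<p - 1})"
  unfolding \<omega>_def[of i] \<omega>_def[of j] by (simp only: power_add[symmetric] \<zeta>_power_in_int_span)

text \<open>The integer span of the \<open>\<omega> i\<close> is closed under multiplication, so
  multiplication by \<open>x\<close> has an integer matrix on these generators.\<close>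

lemma algebraic_int_int_span:
  assumes "x \<in> int_complex.span (\<omega> ` {..<p - 1})"
  shows "algebraic_int x"
proof -
  let ?M = "int_complex.span (\<omega> ` {..<p - 1})"
  have "x * \<omega> j \<in> ?M" for j
    using assms
  proof (induction rule: int_complex.span_induct)
    case base
    show ?case
      by (rule int_complex.subspaceI)
        (auto simp: int_complex.span_zero distrib_right mult.assoc
          intro: int_complex.span_add int_complex.span_scale)
  qed (auto simp: \<omega>_mult_in_int_span)
  then have "\<exists>c. x * \<omega> j = (\<Sum>i<p - 1. of_int (c i) * \<omega> i)" for j
  proof -
    obtain c where "x * \<omega> j = (\<Sum>z\<in>\<omega> ` {..<p - 1}. of_int (c z) * z)"
      using \<open>x * \<omega> j \<in> ?M\<close> by (subst (asm) int_complex.span_finite) auto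
    also have "\<dots> = (\<Sum>i<p - 1. of_int (c (\<omega> i)) * \<omega> i)"
      by (rule sum.reindex_cong[of \<omega>]) (auto intro!: inj_onI \<omega>_inj)
    finally show ?thesis by (intro exI[of _ "\<lambda>i. c (\<omega> i)"])
  qed
  then obtain A where "\<And>j. x * \<omega> j = (\<Sum>i<p - 1. of_int (A j i) * \<omega> i)" by metis
  then show ?thesis
    by (rule algebraic_int_of_multiplication_matrix[of "p - 1" x \<omega> A 0])
      (use p_gt_1 \<zeta>_nonzero in \<open>auto simp: \<omega>_0\<close>)
qed

text \<open>An explicit candidate for \<open>L\<close>. Once it is known to be a field, minimality
  of \<open>L\<close> gives \<open>L_eq_V\<close>, and linear statements about \<open>L\<close> need
  checking on the \<open>\<omega> i\<close> only.\<close>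

definition V :: "complex set" where "V = rat_complex.span (\<omega> ` {..<p - 1})"

lemma V_subspace: "rat_complex.subspace V" unfolding V_def by (rule rat_complex.subspace_span)

lemma int_span_subset_V: "int_complex.span (\<omega> ` {..<p - 1}) \<subseteq> V"
proof (rule int_complex.span_minimal)
  show "int_complex.subspace V"
  proof (rule int_complex.subspaceI)
    fix c x assume "x \<in> V"
    then have "of_rat (of_int c) * x \<in> V" by (rule rat_complex.subspace_scale[OF V_subspace])
    then show "of_int c * x \<in> V" by simp
  qed (auto intro: rat_complex.subspace_0 rat_complex.subspace_add V_subspace)
qed (auto simp: V_def rat_complex.span_base)

lemma \<zeta>_power_in_V: "\<zeta> ^ k \<in> V" using \<zeta>_power_in_int_span int_span_subset_V by blast

lemma \<omega>_in_V: "\<omega> i \<in> V" unfolding \<omega>_def by (rule \<zeta>_power_in_V)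

lemma V_subset_L: "V \<subseteq> L"
  unfolding V_def
  by (rule rat_complex.span_minimal) (auto simp: \<omega>_in_L complex_subfield_subspace L)

lemma V_mult: "x \<in> V \<Longrightarrow> y \<in> V \<Longrightarrow> x * y \<in> V"
proof -
  have 1: "x * \<omega> j \<in> V" if "x \<in> V" for x j
    using that unfolding V_def
  proof (induction rule: rat_complex.span_induct)
    case base
    show ?case
      by (rule rat_complex.subspaceI)
        (auto simp: rat_complex.span_zero distrib_right mult.assoc
          intro: rat_complex.span_add rat_complex.span_scale)
  qed (use \<omega>_mult_in_int_span int_span_subset_V V_def in auto)
  assume x: "x \<in> V" and y: "y \<in> V"
  from y show "x * y \<in> V"
    unfolding V_def
  proof (induction rule: rat_complex.span_induct)
    case base
    show ?case
      by (rule rat_complex.subspaceI)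
        (auto simp: rat_complex.span_zero distrib_left mult.left_commute[of x]
          intro: rat_complex.span_add rat_complex.span_scale)
  qed (use 1[OF x] V_def in auto)
qed

lemma S_in_V: "x \<in> V \<Longrightarrow> S x \<in> V"
proof -
  assume x: "x \<in> V"
  \<comment> \<open>Membership in \<open>L\<close> is carried through the induction, since
    \<open>S\<close> is known to be a homomorphism on \<open>L\<close> only.\<close>
  then have "x \<in> L \<and> S x \<in> V"
    unfolding V_def
  proof (induction rule: rat_complex.span_induct)
    case base
    show ?case
      by (rule rat_complex.subspaceI)
        (auto simp: rat_complex.span_zero S.hom_zero S.hom_add S.hom_mult S.hom_of_rat
          complex_subfield_zero complex_subfield_add complex_subfield_mult complex_subfield_of_rat L
          intro: rat_complex.span_add rat_complex.span_scale)
  qed (use \<omega>_in_L \<omega>_in_V S_\<omega> V_def in auto)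
  then show ?thesis by blast
qed

lemma S_pow_in_V: "x \<in> V \<Longrightarrow> (S ^^ k) x \<in> V"
  by (induction k) (auto intro: S_in_V)

text \<open>By linearity it is enough to consider the generators, each of which has trace
  -1.\<close>

lemma trace_V_in_Rats: "x \<in> V \<Longrightarrow> (\<Sum>k<p - 1. (S ^^ k) x) \<in> \<rat>"
proof -
  assume "x \<in> V"
  then have "x \<in> L \<and> (\<Sum>k<p - 1. (S ^^ k) x) \<in> \<rat>"
    unfolding V_def
  proof (induction rule: rat_complex.span_induct)
    case base
    show ?case
      by (rule rat_complex.subspaceI)
        (auto simp: S_pow.hom_zero S_pow.hom_add S_pow.hom_mult S_pow.hom_of_rat
          sum.distrib sum_distrib_left[symmetric]
          complex_subfield_zero complex_subfield_add complex_subfield_mult complex_subfield_of_rat L)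
  qed (auto simp: \<omega>_in_L S_pow_\<omega> sum_\<omega>_shift)
  then show ?thesis by blast
qed

text \<open>The norm \<open>n\<close> of \<open>x\<close> is fixed by \<open>S\<close>, so it is its own trace divided by \<open>p - 1\<close>, hence
  rational.\<close>

lemma V_inverse:
  assumes x: "x \<in> V"
  shows "inverse x \<in> V"
proof (cases "x = 0")
  case True
  then show ?thesis using x by simp
next
  case False
  define y where "y = (\<Prod>k\<in>{1..<p - 1}. (S ^^ k) x)"
  define n where "n = (\<Prod>k<p - 1. (S ^^ k) x)"
  have p1: "p - 1 > 0" using p_gt_1 by simp
  have xL: "x \<in> L" using x V_subset_L by blast
  have nxy: "n = x * y"
    unfolding n_def y_def lessThan_atLeast0 using p1 by (subst prod.atLeast_Suc_lessThan) (simp_all add: One_nat_def)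
  have one: "1 \<in> V" using \<zeta>_power_in_V[of 0] by simp
  have yV: "y \<in> V"
  proof -
    have "(\<Prod>k\<in>I. (S ^^ k) x) \<in> V" for I
      by (induction I rule: infinite_finite_induct) (use x one V_mult S_pow_in_V in auto)
    then show ?thesis by (simp add: y_def)
  qed
  have nV: "n \<in> V" using nxy x yV V_mult by simp
  have "S n = (\<Prod>k<p - 1. (S ^^ Suc k) x)"
    unfolding n_def by (subst S.hom_prod) (auto simp: S_pow_in_L xL)
  also have "\<dots> = (\<Prod>k<p - 1. (S ^^ k) x)"
  proof -
    \<comment> \<open>With the extra factor \<open>x\<close> both sides are the product of
      \<open>p\<close> iterates, whose last factor is again \<open>x\<close> by periodicity.\<close>
    have "x * (\<Prod>k<p - 1. (S ^^ Suc k) x) = (\<Prod>k<Suc (p - 1). (S ^^ k) x)"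
      by (subst prod.lessThan_Suc_shift) simp
    also have "\<dots> = (\<Prod>k<p - 1. (S ^^ k) x) * x"
      by (simp only: prod.lessThan_Suc S_pow_period[OF xL])
    finally show ?thesis using False by simp
  qed
  finally have Sn: "S n = n" by (simp add: n_def)
  have "(S ^^ k) n = n" for k by (induction k) (simp_all add: Sn)
  then have "of_nat (p - 1) * n \<in> \<rat>" using trace_V_in_Rats[OF nV] by simp
  then have "of_nat (p - 1) * n / of_nat (p - 1) \<in> \<rat>" by (intro Rats_divide) auto
  then have "n \<in> \<rat>" using p1 by simp
  then obtain q where q: "n = of_rat q" by (auto elim: Rats_cases)
  have "n \<noteq> 0"
    unfolding n_def using False S_pow.hom_eq_zero_iff[OF xL] by simp
  then have "inverse x = inverse n * y" using nxy by simp
  also have "inverse n = of_rat (inverse q)" by (simp only: q of_rat_inverse)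
  finally have "inverse x = of_rat (inverse q) * y" .
  then show ?thesis using rat_complex.subspace_scale[OF V_subspace yV] by simp
qed

lemma L_eq_V: "L = V"
proof
  have "complex_subfield V"
    unfolding complex_subfield_def
    using \<zeta>_power_in_V[of 0] V_mult V_inverse rat_complex.subspace_diff[OF V_subspace] by auto
  then show "L \<subseteq> V"
    using \<omega>_in_V[of 0] by (intro rat_adjoin_minimal) (simp_all add: \<omega>_0)
qed (rule V_subset_L)

lemma trace_in_Rats: "x \<in> L \<Longrightarrow> (\<Sum>k<p - 1. (S ^^ k) x) \<in> \<rat>"
  using trace_V_in_Rats L_eq_V by simp

section \<open>The trace from the cyclotomic field to a subfield\<close>

definition fixers :: "complex set \<Rightarrow> nat set" where
  "fixers K = {i. i < p - 1 \<and> (\<forall>y\<in>K. (S ^^ i) y = y)}"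

text \<open>Multiplying out one factor gives \<open>k d\<close> times the sum for \<open>x\<close>
  minus the sum for \<open>b d * x\<close>, both with fewer factors. With no factor left, the sum is
  the rational trace.\<close>

lemma weighted_trace_in_subfield:
  assumes K: "complex_subfield K" "K \<subseteq> L"
    and C: "finite C" "\<And>c. c \<in> C \<Longrightarrow> k c \<in> K" "\<And>c. c \<in> C \<Longrightarrow> b c \<in> L"
    and x: "x \<in> L"
  shows "(\<Sum>g<p - 1. (\<Prod>c\<in>C. k c - (S ^^ g) (b c)) * (S ^^ g) x) \<in> K"
  using C x
proof (induction C arbitrary: x rule: finite_induct)
  case empty
  then obtain q where "(\<Sum>k<p - 1. (S ^^ k) x) = of_rat q"
    using trace_in_Rats by (auto elim: Rats_cases)
  then show ?case using complex_subfield_of_rat[OF K(1)] by simp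
next
  case (insert d C)
  let ?P = "\<lambda>g. \<Prod>c\<in>C. k c - (S ^^ g) (b c)"
  have "(\<Sum>g<p - 1. (\<Prod>c\<in>insert d C. k c - (S ^^ g) (b c)) * (S ^^ g) x) =
      k d * (\<Sum>g<p - 1. ?P g * (S ^^ g) x) - (\<Sum>g<p - 1. ?P g * (S ^^ g) (b d * x))"
    using insert.hyps insert.prems
    by (simp add: S_pow.hom_mult sum_distrib_left sum_subtractf[symmetric] algebra_simps)
  then show ?case
    using insert.IH[of x] insert.IH[of "b d * x"] insert.prems
    by (simp add: complex_subfield_diff[OF K(1)] complex_subfield_mult[OF K(1)]
        complex_subfield_mult[OF L])
qed

text \<open>Choose the factors of the weight so that it vanishes at every power of \<open>S\<close> moving \<open>K\<close>
  and is a nonzero constant on those fixing \<open>K\<close>; the case \<open>x = 1\<close> puts that constant in \<open>K\<close>.\<close>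

lemma fixed_trace_in_subfield:
  assumes K: "complex_subfield K" "K \<subseteq> L" and x: "x \<in> L"
  shows "(\<Sum>i\<in>fixers K. (S ^^ i) x) \<in> K"
proof -
  define C where "C = {..<p - 1} - fixers K"
  have "\<exists>y. y \<in> K \<and> (S ^^ c) y \<noteq> y" if "c \<in> C" for c
    using that by (auto simp: C_def fixers_def)
  then obtain k where k: "\<And>c. c \<in> C \<Longrightarrow> k c \<in> K" "\<And>c. c \<in> C \<Longrightarrow> (S ^^ c) (k c) \<noteq> k c" by metis
  then have kL: "k c \<in> L" if "c \<in> C" for c using that K by blast
  \<comment> \<open>As \<open>b c\<close> is the preimage of \<open>k c\<close> under
    \<open>S ^^ c\<close>, the factor of \<open>c\<close> vanishes at \<open>g = c\<close>. Powers
    of \<open>S\<close> that fix \<open>K\<close> also fix \<open>b c\<close>, because powers of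
    \<open>S\<close> commute.\<close>
  define b where "b c = (S ^^ (p - 1 - c)) (k c)" for c
  have bL: "b c \<in> L" if "c \<in> C" for c using kL[OF that] S_pow_in_L by (simp add: b_def)
  have Sb: "(S ^^ c) (b c) = k c" if "c \<in> C" for c
  proof -
    have "c + (p - 1 - c) = p - 1" using that by (auto simp: C_def)
    then have "(S ^^ c) (b c) = (S ^^ (p - 1)) (k c)"
      unfolding b_def by (metis comp_apply funpow_add)
    then show ?thesis using S_pow_period[OF kL[OF that]] by simp
  qed
  define w where "w = (\<Prod>c\<in>C. k c - b c)"
  have wt: "(\<Prod>c\<in>C. k c - (S ^^ g) (b c)) = (if g \<in> fixers K then w else 0)" if g: "g < p - 1" for g
  proof (cases "g \<in> fixers K")
    case True
    have "(S ^^ g) (b c) = b c" if "c \<in> C" for c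
    proof -
      have "(S ^^ g) (b c) = (S ^^ (p - 1 - c)) ((S ^^ g) (k c))"
        unfolding b_def by (metis add.commute comp_apply funpow_add)
      then show ?thesis using True k(1)[OF that] by (simp add: fixers_def b_def)
    qed
    then show ?thesis using True by (simp add: w_def)
  next
    case False
    then have "g \<in> C" using g by (simp add: C_def)
    then show ?thesis using False Sb[of g] by (auto simp: C_def intro!: prod_zero bexI[of _ g])
  qed
  have eq: "(\<Sum>g<p - 1. (\<Prod>c\<in>C. k c - (S ^^ g) (b c)) * (S ^^ g) z) = w * (\<Sum>i\<in>fixers K. (S ^^ i) z)" for z
  proof -
    have "(\<Sum>g<p - 1. (\<Prod>c\<in>C. k c - (S ^^ g) (b c)) * (S ^^ g) z) =
        (\<Sum>g<p - 1. if g \<in> fixers K then w * (S ^^ g) z else 0)"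
      using wt by (intro sum.cong) auto
    also have "\<dots> = (\<Sum>g\<in>{..<p - 1} \<inter> fixers K. w * (S ^^ g) z)"
      by (simp add: sum.inter_restrict)
    also have "{..<p - 1} \<inter> fixers K = fixers K" by (auto simp: fixers_def)
    finally show ?thesis by (simp add: sum_distrib_left)
  qed
  have in_K: "w * (\<Sum>i\<in>fixers K. (S ^^ i) z) \<in> K" if "z \<in> L" for z
    using weighted_trace_in_subfield[OF K, of C k b z] k(1) bL that
    unfolding eq by (simp add: C_def)
  have "w \<noteq> 0"
  proof -
    have "k c \<noteq> b c" if "c \<in> C" for c using Sb[OF that] k(2)[OF that] by auto
    then show ?thesis by (auto simp: w_def C_def)
  qed
  have fin: "finite (fixers K)" and ne: "0 \<in> fixers K"
    using p_gt_1 by (auto simp: fixers_def)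
  have m: "card (fixers K) \<noteq> 0" using fin ne by auto
  have "w * of_nat (card (fixers K)) \<in> K"
    using in_K[of 1] complex_subfield_one[OF L] by (simp add: S_pow.hom_one)
  then have "w \<in> K"
    using m complex_subfield_divide[OF K(1) _ complex_subfield_of_nat[OF K(1)], of "w * of_nat (card (fixers K))" "card (fixers K)"]
    by simp
  then show ?thesis
    using complex_subfield_divide[OF K(1) in_K[OF x], of w] \<open>w \<noteq> 0\<close> by simp
qed

end

section \<open>Gaussian periods and subfields\<close>

context cyclotomic
begin

text \<open>For \<open>N\<close> dividing \<open>p - 1\<close> this is the Gaussian period of a
  coset of the subgroup of index \<open>N\<close> in the units modulo \<open>p\<close>;
  \<open>r ^ i\<close> represents the coset.\<close>

definition period :: "nat \<Rightarrow> nat \<Rightarrow> complex" where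
  "period N i = (\<Sum>a<(p - 1) div N. \<omega> (i + N * a))"

lemma period_in_L: "period N i \<in> L"
  unfolding period_def by (intro complex_subfield_sum L \<omega>_in_L)

lemma S_pow_period_shift: "(S ^^ k) (period N i) = period N (i + k)"
  unfolding period_def
  by (simp add: S_pow.hom_sum \<omega>_in_L S_pow_\<omega> add_ac)

text \<open>Shifting by \<open>N\<close> drops the first term and appends one whose index is larger
  by \<open>p - 1\<close>, which is the same number.\<close>

lemma period_add_N:
  assumes N: "N dvd p - 1"
  shows "period N (i + N) = period N i"
proof -
  let ?m = "(p - 1) div N"
  have "\<omega> i + period N (i + N) = (\<Sum>a<Suc ?m. \<omega> (i + N * a))"
    unfolding period_def by (subst sum.lessThan_Suc_shift) (simp add: add_ac)
  also have "\<dots> = period N i + \<omega> (i + N * ?m)" by (simp add: period_def)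
  also have "N * ?m = p - 1" using N by simp
  finally show ?thesis by simp
qed

lemma period_mod: "N dvd p - 1 \<Longrightarrow> period N (i mod N) = period N i"
proof -
  assume N: "N dvd p - 1"
  have "period N (j + N * q) = period N j" for j q
  proof (induction q)
    case (Suc q)
    then show ?case using period_add_N[OF N, of "j + N * q"] by (simp add: add_ac)
  qed simp
  from this[of "i mod N" "i div N"] show ?thesis by simp
qed

text \<open>Since the second period depends on its index modulo \<open>N\<close> only, the sum over
  \<open>k\<close> merges with the one inside the first period into a sum over all indices below
  \<open>p - 1\<close>. Then \<open>\<omega>_orthogonality\<close> applies to each term of the
  second period.\<close>

lemma period_orthogonality:
  assumes N: "N dvd p - 1" and ij: "i < N" "j < N"
  shows "(\<Sum>k<N. period N (i + k) * cnj (period N (j + k))) =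
    (if i = j then of_nat p else 0) - of_nat ((p - 1) div N)"
proof -
  define m where "m = (p - 1) div N"
  have mN: "m * N = p - 1" "N * m = p - 1" using N by (auto simp: m_def)
  \<comment> \<open>An index \<open>t = k + a * N\<close> encodes both the shift \<open>k\<close>
    and the position \<open>a\<close> inside the first period.\<close>
  define F where "F t = \<omega> (i + t) * cnj (period N (j + t))" for t
  have "(\<Sum>k<N. period N (i + k) * cnj (period N (j + k))) = (\<Sum>k<N. \<Sum>a<m. F (k + a * N))"
  proof (rule sum.cong)
    fix k
    have "(j + (k + a * N)) mod N = (j + k) mod N" for a
      by (metis add.assoc mod_mult_self1)
    then have "period N (j + (k + a * N)) = period N (j + k)" for a
      by (metis period_mod[OF N])
    then have "F (k + a * N) = \<omega> (i + k + N * a) * cnj (period N (j + k))" for a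
      by (simp only: F_def add.assoc mult.commute[of N a])
    then show "period N (i + k) * cnj (period N (j + k)) = (\<Sum>a<m. F (k + a * N))"
      unfolding period_def[of N "i + k"] m_def[symmetric] by (simp add: sum_distrib_right)
  qed simp
  also have "\<dots> = (\<Sum>a<m. \<Sum>k<N. F (k + a * N))" by (rule sum.swap)
  also have "\<dots> = (\<Sum>a<m. sum F {a * N..<a * N + N})"
  proof (rule sum.cong)
    fix a
    show "(\<Sum>k<N. F (k + a * N)) = sum F {a * N..<a * N + N}"
      using sum.shift_bounds_nat_ivl[of F 0 "a * N" N] by (simp add: lessThan_atLeast0 add.commute)
  qed simp
  also have "\<dots> = sum F {..<m * N}" by (rule sum.nat_group)
  also have "\<dots> = (\<Sum>t<p - 1. \<Sum>b<m. \<omega> (i + t) * cnj (\<omega> (j + N * b + t)))"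
    unfolding mN F_def period_def m_def[symmetric] by (simp add: sum_distrib_left ac_simps)
  also have "\<dots> = (\<Sum>b<m. \<Sum>t<p - 1. \<omega> (i + t) * cnj (\<omega> (j + N * b + t)))" by (rule sum.swap)
  also have "\<dots> = (\<Sum>b<m. (if b = 0 \<and> i = j then of_nat p else 0) - 1)"
  proof (rule sum.cong)
    fix b assume "b \<in> {..<m}"
    then have b: "b < m" by simp
    have "N * b + N \<le> N * m" using b by (metis Suc_leI add.commute mult_Suc_right mult_le_mono2)
    then have "j + N * b < p - 1" "i < p - 1" using ij mN(2) by linarith+
    then have "[i = j + N * b] (mod (p - 1)) \<longleftrightarrow> i = j + N * b" by (simp add: cong_def)
    also have "\<dots> \<longleftrightarrow> b = 0 \<and> i = j" using ij by (cases b) auto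
    finally show "(\<Sum>t<p - 1. \<omega> (i + t) * cnj (\<omega> (j + N * b + t))) =
        (if b = 0 \<and> i = j then of_nat p else 0) - 1"
      by (simp only: \<omega>_orthogonality)
  qed simp
  also have "\<dots> = (\<Sum>b<m. if b = 0 then (if i = j then of_nat p else 0) else 0) - of_nat m"
    unfolding sum_subtractf by (auto intro!: sum.cong arg_cong2[of _ _ _ _ "(-)"])
  also have "(\<Sum>b<m. if b = 0 then (if i = j then of_nat p else 0) else 0) = (if i = j then of_nat p else 0 :: complex)"
  proof -
    have "0 < m" using mN p_gt_1 by (cases m) auto
    then show ?thesis by simp
  qed
  finally show ?thesis by (simp add: m_def)
qed

text \<open>Pairing the relation and its conjugates with the period of \<open>j\<close> gives
  \<open>p * q j = m * Q\<close> for the coefficient sum \<open>Q\<close>. Summing over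
  \<open>j\<close> yields \<open>p * Q = (p - 1) * Q\<close>, so \<open>Q\<close> and then every
  coefficient vanishes.\<close>

lemma period_independent:
  assumes N: "N dvd p - 1"
    and zero: "(\<Sum>i<N. of_rat (q i) * period N i) = 0" and j: "j < N"
  shows "q j = 0"
proof -
  define m where "m = (p - 1) div N"
  have mN: "N * m = p - 1" using N by (auto simp: m_def)
  define Q where "Q = (\<Sum>i<N. of_rat (q i) :: complex)"
  have zk: "(\<Sum>i<N. of_rat (q i) * period N (i + k)) = 0" for k
  proof -
    have "(S ^^ k) (\<Sum>i<N. of_rat (q i) * period N i) = (\<Sum>i<N. of_rat (q i) * period N (i + k))"
      by (simp add: S_pow.hom_sum S_pow.hom_mult S_pow.hom_of_rat S_pow_period_shift
          period_in_L complex_subfield_mult complex_subfield_of_rat L)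
    then show ?thesis using zero by (simp add: S_pow.hom_zero)
  qed
  have coord: "of_nat p * of_rat (q j) = of_nat m * Q" if j: "j < N" for j
  proof -
    have "0 = (\<Sum>k<N. (\<Sum>i<N. of_rat (q i) * period N (i + k)) * cnj (period N (j + k)))"
      by (simp add: zk)
    also have "\<dots> = (\<Sum>i<N. of_rat (q i) * (\<Sum>k<N. period N (i + k) * cnj (period N (j + k))))"
      by (simp only: sum_distrib_right sum_distrib_left mult.assoc) (rule sum.swap)
    also have "\<dots> = (\<Sum>i<N. of_rat (q i) * ((if i = j then of_nat p else 0) - of_nat m))"
      using j by (intro sum.cong) (simp_all add: period_orthogonality[OF N] m_def)
    also have "\<dots> = (\<Sum>i<N. (if i = j then of_rat (q j) * of_nat p else 0) - of_rat (q i) * of_nat m)"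
      by (intro sum.cong) (auto simp: algebra_simps)
    also have "\<dots> = of_rat (q j) * of_nat p - Q * of_nat m"
      using j by (simp add: sum_subtractf Q_def sum_distrib_right)
    finally show ?thesis by (simp add: algebra_simps)
  qed
  have "of_nat p * Q = (\<Sum>j<N. of_nat p * of_rat (q j))" by (simp add: Q_def sum_distrib_left)
  also have "\<dots> = of_nat (N * m) * Q" using coord by (simp add: mult.assoc)
  also have "\<dots> = (of_nat p - 1) * Q" using mN p_gt_1 by (simp add: of_nat_diff)
  finally have "Q = 0" by (simp add: algebra_simps)
  then show ?thesis using coord[OF j] p_gt_1 by simp
qed

lemma period_inj: "N dvd p - 1 \<Longrightarrow> i < N \<Longrightarrow> j < N \<Longrightarrow> period N i = period N j \<Longrightarrow> i = j"
proof (rule ccontr)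
  assume N: "N dvd p - 1" and ij: "i < N" "j < N" "period N i = period N j" "i \<noteq> j"
  define q :: "nat \<Rightarrow> rat" where "q l = (if l = i then 1 else 0) - (if l = j then 1 else 0)" for l
  have "(\<Sum>l<N. of_rat (q l) * period N l) =
      (\<Sum>l<N. (if l = i then period N i else 0) - (if l = j then period N j else 0))"
    by (intro sum.cong) (auto simp: q_def of_rat_diff)
  also have "\<dots> = 0" using ij by (simp add: sum_subtractf)
  finally have "q i = 0" using period_independent[OF N _ ij(1)] by blast
  then show False using ij by (simp add: q_def)
qed

lemma dim_span_periods:
  assumes N: "N dvd p - 1"
  shows "rat_complex.dim (rat_complex.span (period N ` {..<N})) = N"
proof -
  have inj: "inj_on (period N) {..<N}" using period_inj[OF N] by (auto intro: inj_onI)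
  have "rat_complex.independent (period N ` {..<N})"
  proof (rule rat_complex.independent_if_scalars_zero)
    fix f x assume 0: "(\<Sum>x\<in>period N ` {..<N}. of_rat (f x) * x) = 0" and x: "x \<in> period N ` {..<N}"
    have "(\<Sum>i<N. of_rat (f (period N i)) * period N i) = 0"
      using 0 by (simp add: sum.reindex[OF inj])
    then show "f x = 0" using period_independent[OF N, of "\<lambda>i. f (period N i)"] x by auto
  qed simp
  then show ?thesis
    using inj by (simp add: rat_complex.dim_eq_card_independent card_image)
qed

end

section \<open>Gaussian periods as a rational basis of a subfield\<close>

locale cyclotomic_subfield = cyclotomic +
  fixes K :: "complex set" and s :: nat
  assumes K: "complex_subfield K" and K_subset_L: "K \<subseteq> L" and degree: "degree_over_rat K = s"
begin

sublocale S_pow_K: subfield_hom K "S ^^ k" for k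
  using field_hom_S_pow[of k] K K_subset_L
  by unfold_locales (auto simp: field_hom_def subset_iff)

text \<open>The order of \<open>S\<close> on \<open>K\<close>. It is kept apart from the degree
  \<open>s\<close> until \<open>N_eq\<close> identifies the two by comparing dimensions.\<close>

definition N :: nat where "N = (LEAST n. n > 0 \<and> (\<forall>y\<in>K. (S ^^ n) y = y))"

lemma N_pos: "N > 0" and N_fixes: "y \<in> K \<Longrightarrow> (S ^^ N) y = y"
  and N_least: "n > 0 \<Longrightarrow> (\<And>y. y \<in> K \<Longrightarrow> (S ^^ n) y = y) \<Longrightarrow> N \<le> n"
proof -
  have "p - 1 > 0 \<and> (\<forall>y\<in>K. (S ^^ (p - 1)) y = y)"
    using p_gt_1 S_pow_period K_subset_L by auto
  then have "N > 0 \<and> (\<forall>y\<in>K. (S ^^ N) y = y)" unfolding N_def by (rule LeastI)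
  then show "N > 0" "y \<in> K \<Longrightarrow> (S ^^ N) y = y" by auto
  show "n > 0 \<Longrightarrow> (\<And>y. y \<in> K \<Longrightarrow> (S ^^ n) y = y) \<Longrightarrow> N \<le> n"
    unfolding N_def by (intro Least_le) auto
qed

lemma S_pow_mod_N: "y \<in> K \<Longrightarrow> (S ^^ (i mod N)) y = (S ^^ i) y"
proof -
  assume y: "y \<in> K"
  have "(S ^^ (N * q)) y = y" for q
    by (induction q) (simp_all add: funpow_add N_fixes[OF y])
  moreover have "(S ^^ i) y = (S ^^ (i mod N)) ((S ^^ (N * (i div N))) y)"
    by (metis comp_apply funpow_add mod_mult_div_eq)
  ultimately show ?thesis by simp
qed

lemma fixes_K_iff: "(\<forall>y\<in>K. (S ^^ i) y = y) \<longleftrightarrow> N dvd i"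
proof
  assume "\<forall>y\<in>K. (S ^^ i) y = y"
  then have "\<And>y. y \<in> K \<Longrightarrow> (S ^^ (i mod N)) y = y" by (simp add: S_pow_mod_N)
  then have "\<not> i mod N > 0"
    using N_least[of "i mod N"] N_pos mod_less_divisor[of N i] by (meson not_le)
  then show "N dvd i" by auto
next
  assume "N dvd i"
  then show "\<forall>y\<in>K. (S ^^ i) y = y" using S_pow_mod_N[of _ i] by auto
qed

lemma N_dvd: "N dvd p - 1"
  using fixes_K_iff S_pow_period K_subset_L by blast

lemma fixers_eq: "fixers K = (\<lambda>a. N * a) ` {..<(p - 1) div N}"
proof -
  have lt: "N * a < p - 1 \<longleftrightarrow> a < (p - 1) div N" for a
    using N_dvd N_pos by (metis dvd_mult_div_cancel mult_less_cancel1)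
  have "fixers K = {i. i < p - 1 \<and> (\<exists>a. i = N * a)}"
    unfolding fixers_def fixes_K_iff dvd_def ..
  also have "\<dots> = (\<lambda>a. N * a) ` {..<(p - 1) div N}"
    by (auto simp only: lt[symmetric] lessThan_iff image_iff mem_Collect_eq)
  finally show ?thesis .
qed

lemma sum_fixers: "(\<Sum>i\<in>fixers K. f i) = (\<Sum>a<(p - 1) div N. f (N * a))"
  unfolding fixers_eq using N_pos by (subst sum.reindex) (auto simp: inj_on_def)

lemma period_in_K: "period N i \<in> K"
  using fixed_trace_in_subfield[OF K K_subset_L \<omega>_in_L, of i]
  by (simp add: sum_fixers S_pow_\<omega> period_def)

text \<open>The trace from \<open>L\<close> to \<open>K\<close> sends the generators
  \<open>\<omega> j\<close> to periods, hence \<open>L\<close> into their span; on \<open>K\<close>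
  it is multiplication by a positive integer, which can be divided out.\<close>

lemma K_eq_span: "K = rat_complex.span (period N ` {..<N})"
proof
  show "rat_complex.span (period N ` {..<N}) \<subseteq> K"
    using period_in_K by (intro rat_complex.span_minimal complex_subfield_subspace K) auto
next
  let ?W = "rat_complex.span (period N ` {..<N})"
  have trace: "(\<Sum>i\<in>fixers K. (S ^^ i) x) \<in> ?W" if "x \<in> L" for x
  proof -
    have "x \<in> rat_complex.span (\<omega> ` {..<p - 1})" using that L_eq_V V_def by simp
    then have "x \<in> L \<and> (\<Sum>i\<in>fixers K. (S ^^ i) x) \<in> ?W"
    proof (induction rule: rat_complex.span_induct)
      case base
      show ?case
        by (rule rat_complex.subspaceI)
          (auto simp: S_pow.hom_zero S_pow.hom_add S_pow.hom_mult S_pow.hom_of_rat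
            sum.distrib sum_distrib_left[symmetric] rat_complex.span_zero
            complex_subfield_zero complex_subfield_add complex_subfield_mult complex_subfield_of_rat L
            intro: rat_complex.span_add rat_complex.span_scale)
    next
      case (step x)
      then obtain j where j: "x = \<omega> j" by blast
      have "(\<Sum>i\<in>fixers K. (S ^^ i) x) = period N (j mod N)"
        by (simp add: j sum_fixers S_pow_\<omega> period_mod[OF N_dvd]) (simp add: period_def)
      then show ?case using j \<omega>_in_L N_pos by (auto intro!: rat_complex.span_base)
    qed
    then show ?thesis by blast
  qed
  show "K \<subseteq> ?W"
  proof
    fix x assume x: "x \<in> K"
    define m where "m = (p - 1) div N"
    have "m > 0" using N_dvd N_pos p_gt_1 unfolding m_def by (metis dvd_div_eq_0_iff gr0I zero_less_diff less_numeral_extra(3))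
    have "(\<Sum>i\<in>fixers K. (S ^^ i) x) = of_nat m * x"
    proof -
      have "(S ^^ (N * a)) x = x" for a using x fixes_K_iff[of "N * a"] by simp
      then show ?thesis by (simp add: sum_fixers m_def)
    qed
    then have "of_nat m * x \<in> ?W" using trace[of x] x K_subset_L by (simp add: subset_iff)
    then have "of_rat (1 / of_nat m) * (of_nat m * x) \<in> ?W" by (rule rat_complex.span_scale)
    then show "x \<in> ?W" using \<open>m > 0\<close> by (simp add: of_rat_divide)
  qed
qed

lemma N_eq: "N = s"
  using degree dim_span_periods[OF N_dvd] K_eq_span unfolding degree_over_rat_def by simp

lemma s_dvd: "s dvd p - 1" and s_pos: "s > 0"
  using N_dvd N_pos N_eq by simp_all

text \<open>An embedding maps \<zeta> to a root of unity of order dividing \<open>p\<close>, which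
  by injectivity is not 1. It is thus some \<open>\<omega> i\<close>, and the embedding agrees with
  \<open>S ^^ i\<close> on the generator of \<open>L\<close>.\<close>

lemma embedding_L_cases:
  assumes "f \<in> embeddings L"
  obtains i where "i < p - 1" "f = restrict (S ^^ i) L"
proof -
  interpret f: subfield_hom L f
    using assms L by unfold_locales (simp_all add: embeddings_iff_field_hom)
  have \<zeta>L: "\<zeta> \<in> L" by (rule rat_adjoin_self)
  have roots: "(\<lambda>c. \<zeta> ^ c) ` {..<p} = {z. z ^ p = 1}"
  proof (rule card_seteq)
    show "finite {z::complex. z ^ p = 1}" using p_gt_1 by (intro finite_roots_unity) simp
    show "(\<lambda>c. \<zeta> ^ c) ` {..<p} \<subseteq> {z. z ^ p = 1}"
      by (auto simp: power_mult[symmetric] \<zeta>_power_eq_1_iff)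
    have "inj_on (\<lambda>c. \<zeta> ^ c) {..<p}"
    proof (rule linorder_inj_onI)
      fix a b assume ab: "a < b" "a \<in> {..<p}" "b \<in> {..<p}"
      have "\<zeta> ^ b = \<zeta> ^ a * \<zeta> ^ (b - a)" using ab by (simp add: power_add[symmetric])
      moreover have "\<zeta> ^ (b - a) \<noteq> 1" using ab by (auto simp: \<zeta>_power_eq_1_iff dest: dvd_imp_le)
      ultimately show "\<zeta> ^ a \<noteq> \<zeta> ^ b" using \<zeta>_nonzero by simp
    qed (simp add: nat_le_linear)
    then show "card {z::complex. z ^ p = 1} \<le> card ((\<lambda>c. \<zeta> ^ c) ` {..<p})"
      using p_gt_1 card_roots_unity[of p, where 'a = complex] by (simp add: card_image)
  qed
  have "f \<zeta> ^ p = 1" using f.hom_power[OF \<zeta>L, of p] \<zeta>_power_eq_1_iff[of p] f.hom_one by simp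
  then obtain c where c: "f \<zeta> = \<zeta> ^ c" using roots by blast
  have "\<zeta> \<noteq> 1" using \<zeta>_power_eq_1_iff[of 1] p_gt_1 by simp
  then have "f \<zeta> \<noteq> 1" using f.hom_inj[OF \<zeta>L complex_subfield_one[OF L]] f.hom_one by simp
  then have "\<not> p dvd c" using c \<zeta>_power_eq_1_iff by simp
  then obtain i where i: "i < p - 1" "f \<zeta> = \<omega> i" using \<zeta>_power_eq_\<omega> c by metis
  have "f x = (S ^^ i) x" if "x \<in> L" for x
    by (rule field_hom_eq_on_rat_adjoin[OF f.f field_hom_S_pow _ that]) (simp add: S_pow_\<zeta> i(2))
  moreover have "f \<in> extensional L" using assms by (simp add: embeddings_def)
  ultimately have "f = restrict (S ^^ i) L"
    by (intro extensionalityI[of _ L]) auto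
  with i(1) that show ?thesis by blast
qed

lemma restrict_S_pow_embedding: "restrict (S ^^ i) K \<in> embeddings K"
  using S_pow_K.f[of i] complex_subfield_one[OF K] complex_subfield_add[OF K] complex_subfield_mult[OF K]
  by (auto simp: embeddings_iff_field_hom field_hom_def)

lemma restrict_S_pow_embedding_L: "restrict (S ^^ i) L \<in> embeddings L"
  using field_hom_S_pow[of i] complex_subfield_one[OF L] complex_subfield_add[OF L] complex_subfield_mult[OF L]
  by (auto simp: embeddings_iff_field_hom field_hom_def)

text \<open>The embeddings that fix \<open>K\<close> correspond to \<open>fixers K\<close>; they are
  distinct because they send \<zeta> to distinct \<open>\<omega> i\<close>. The terms of the trace
  are those of the period.\<close>

lemma rel_trace_\<zeta>: "rel_trace L K \<zeta> = period s 0"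
proof -
  let ?R = "\<lambda>i. restrict (S ^^ i) L"
  have fix_iff: "(\<forall>y\<in>K. ?R i y = y) \<longleftrightarrow> (\<forall>y\<in>K. (S ^^ i) y = y)" for i
    using K_subset_L by (auto simp: subset_iff)
  have "{f \<in> embeddings L. \<forall>y\<in>K. f y = y} = ?R ` fixers K"
  proof (intro subset_antisym subsetI)
    fix f assume f: "f \<in> {f \<in> embeddings L. \<forall>y\<in>K. f y = y}"
    then obtain i where i: "i < p - 1" "f = ?R i" using embedding_L_cases by blast
    then have "i \<in> fixers K" using f fix_iff[of i] by (simp add: fixers_def)
    then show "f \<in> ?R ` fixers K" using i(2) by blast
  next
    fix f assume "f \<in> ?R ` fixers K"
    then obtain i where i: "i \<in> fixers K" "f = ?R i" by blast
    then have "\<forall>y\<in>K. ?R i y = y" unfolding fix_iff by (simp add: fixers_def)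
    then show "f \<in> {f \<in> embeddings L. \<forall>y\<in>K. f y = y}"
      using i(2) restrict_S_pow_embedding_L by blast
  qed
  moreover have "inj_on ?R (fixers K)"
  proof (rule inj_onI)
    fix i j assume ij: "i \<in> fixers K" "j \<in> fixers K" "?R i = ?R j"
    then have "?R i \<zeta> = ?R j \<zeta>" by simp
    then have "\<omega> i = \<omega> j" by (simp add: rat_adjoin_self S_pow_\<zeta>)
    then show "i = j" using ij \<omega>_inj by (auto simp: fixers_def)
  qed
  ultimately have "rel_trace L K \<zeta> = (\<Sum>i\<in>fixers K. ?R i \<zeta>)"
    unfolding rel_trace_def by (simp add: sum.reindex)
  also have "\<dots> = (\<Sum>i\<in>fixers K. \<omega> i)" by (simp add: rat_adjoin_self S_pow_\<zeta>)
  finally show ?thesis by (simp add: sum_fixers period_def N_eq)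
qed

lemma inj_restrict_S_pow: "inj_on (\<lambda>i. restrict (S ^^ i) K) {..<s}"
proof (rule inj_onI)
  fix i j assume ij: "i \<in> {..<s}" "j \<in> {..<s}" "restrict (S ^^ i) K = restrict (S ^^ j) K"
  then have "restrict (S ^^ i) K (period s 0) = restrict (S ^^ j) K (period s 0)" by simp
  then have "period s i = period s j"
    using period_in_K[of 0] by (simp add: N_eq S_pow_period_shift)
  then show "i = j" using ij period_inj[OF s_dvd] by auto
qed

text \<open>The first \<open>s\<close> powers of \<open>S\<close> have distinct restrictions, so
  they exhaust the embeddings as soon as the number of these is \<open>s\<close>. The given
  enumeration provides that number.\<close>

lemma embeddings_K:
  assumes "card (embeddings K) = s"
  shows "embeddings K = (\<lambda>i. restrict (S ^^ i) K) ` {..<s}"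
proof (rule card_seteq[symmetric])
  show "finite (embeddings K)" using assms s_pos card_gt_0_iff by metis
  show "card (embeddings K) \<le> card ((\<lambda>i. restrict (S ^^ i) K) ` {..<s})"
    using assms inj_restrict_S_pow by (simp add: card_image)
qed (auto simp: restrict_S_pow_embedding)

text \<open>The iterates stay inside \<open>K\<close>, where the restricted map agrees with
  \<open>S\<close>.\<close>

lemma theta_pow_t: "((restrict S K) ^^ i) (period s 0) = period s i"
proof (induction i)
  case (Suc i)
  have "period s i \<in> K" using period_in_K N_eq by metis
  then show ?case using Suc S_pow_period_shift[of 1 s i] by (simp add: One_nat_def)
qed simp

lemma period_combination_in_ring_of_integers:
  "(\<Sum>i<s. of_int (a i) * period s i) \<in> ring_of_integers K"
proof -
  have "\<omega> i \<in> int_complex.span (\<omega> ` {..<p - 1})" for i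
    unfolding \<omega>_def[of i] by (rule \<zeta>_power_in_int_span)
  then have "(\<Sum>i<s. of_int (a i) * period s i) \<in> int_complex.span (\<omega> ` {..<p - 1})"
    unfolding period_def
    by (intro int_complex.span_sum int_complex.span_scale)
  moreover have "(\<Sum>i<s. of_int (a i) * period s i) \<in> K"
    using period_in_K N_eq
    by (intro complex_subfield_sum K complex_subfield_mult complex_subfield_of_int) auto
  ultimately show ?thesis by (simp add: ring_of_integers_def algebraic_int_int_span)
qed

end

section \<open>The canonical embedding of the subfield\<close>

lemma sum_lessThan_add:
  fixes f :: "nat \<Rightarrow> 'a :: comm_monoid_add"
  shows "(\<Sum>i<m + n. f i) = (\<Sum>i<m. f i) + (\<Sum>i<n. f (m + i))"
  by (induction n) (simp_all add: add.assoc)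

lemma sum_lessThan_double:
  fixes f :: "nat \<Rightarrow> 'a :: comm_monoid_add"
  shows "(\<Sum>i<2 * n. f i) = (\<Sum>i<n. f (2 * i) + f (2 * i + 1))"
  by (induction n) (simp_all add: add_ac One_nat_def)

lemma power_int_mod_root_of_unity:
  assumes z: "primitive_root_of_unity n z" and n: "n > 0"
  shows "z powi u = z ^ nat (u mod int n)"
proof -
  have zn: "z ^ n = 1" using z by (simp add: primitive_root_of_unity_def)
  then have z0: "z \<noteq> 0" using n by (auto simp: power_0_left)
  have "z powi u = z powi (int n * (u div int n) + u mod int n)" by simp
  also have "\<dots> = (z powi int n) powi (u div int n) * z powi (u mod int n)"
    using z0 by (subst power_int_add) (auto simp: power_int_mult)
  also have "\<dots> = z powi (u mod int n)" using zn by simp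
  also have "\<dots> = z ^ nat (u mod int n)" using n by (simp add: power_int_def)
  finally show ?thesis .
qed

text \<open>A primitive root has order \<open>p - 1\<close>, a multiple of \<open>s\<close>, so its
  power with exponent \<open>(p - 1) div s\<close> has order \<open>s\<close>. Passing to the
  residue \<open>b\<close> makes orders of natural numbers applicable.\<close>

lemma root_code_primroot:
  assumes p: "prime p" and s: "s > 0" "s dvd p - 1" and \<beta>: "int_primroot p \<beta>"
  shows "root_code (int p) s (\<beta> ^ ((p - 1) div s))"
proof
  define m where "m = (p - 1) div s"
  define b where "b = nat (\<beta> mod int p)"
  have ms: "m * s = p - 1" using s by (simp add: m_def)
  have p1: "p > 1" using p by (rule prime_gt_1_nat)
  have m: "m > 0" using ms p1 by (cases m) auto
  have b: "coprime p b" "ord p b = p - 1"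
    using \<beta> p by (auto simp: int_primroot_def b_def residue_primroot_def totient_prime)
  have \<beta>b: "[\<beta> = int b] (mod int p)" using p1 by (simp add: b_def cong_def)
  fix i j
  have pw: "[(\<beta> ^ m) ^ l = int (b ^ (m * l))] (mod int p)" for l
    using cong_pow[OF \<beta>b, of "m * l"] by (simp add: power_mult)
  have "[(\<beta> ^ m) ^ i = (\<beta> ^ m) ^ j] (mod int p) \<longleftrightarrow> [int (b ^ (m * i)) = int (b ^ (m * j))] (mod int p)"
    using pw[of i] pw[of j] by (simp only: cong_def)
  also have "\<dots> \<longleftrightarrow> [b ^ (m * i) = b ^ (m * j)] (mod p)" by (rule cong_int_iff)
  also have "\<dots> \<longleftrightarrow> [m * i = m * j] (mod (m * s))"
    using order_divides_expdiff[OF b(1)] b(2) ms by simp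
  also have "\<dots> \<longleftrightarrow> [i = j] (mod s)" using m by (simp add: cong_def mult_mod_right[symmetric])
  finally show "[(\<beta> ^ ((p - 1) div s)) ^ i = (\<beta> ^ ((p - 1) div s)) ^ j] (mod int p) \<longleftrightarrow> [i = j] (mod s)"
    by (simp only: m_def)
qed (use p s in auto)

text \<open>Expanding the product and summing over \<open>k\<close> first reduces the form to
  \<open>period_orthogonality\<close>.\<close>

lemma (in cyclotomic) period_norm_form:
  fixes a :: "nat \<Rightarrow> int"
  assumes N: "N dvd p - 1"
  shows "(\<Sum>k<N. (\<Sum>i<N. of_int (a i) * period N (i + k)) * cnj (\<Sum>j<N. of_int (a j) * period N (j + k))) =
    of_int (int p * (\<Sum>i<N. (a i)\<^sup>2) - int ((p - 1) div N) * (\<Sum>i<N. a i)\<^sup>2)"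
proof -
  define m where "m = (p - 1) div N"
  have "(\<Sum>k<N. (\<Sum>i<N. of_int (a i) * period N (i + k)) * cnj (\<Sum>j<N. of_int (a j) * period N (j + k))) =
    (\<Sum>k<N. \<Sum>i<N. \<Sum>j<N. of_int (a i) * of_int (a j) * (period N (i + k) * cnj (period N (j + k))))"
    unfolding cnj_sum sum_product by (intro sum.cong refl) simp
  also have "\<dots> = (\<Sum>i<N. \<Sum>k<N. \<Sum>j<N. of_int (a i) * of_int (a j) * (period N (i + k) * cnj (period N (j + k))))"
    by (rule sum.swap)
  also have "\<dots> = (\<Sum>i<N. \<Sum>j<N. \<Sum>k<N. of_int (a i) * of_int (a j) * (period N (i + k) * cnj (period N (j + k))))"
    by (intro sum.cong refl sum.swap)
  also have "\<dots> = (\<Sum>i<N. \<Sum>j<N. of_int (a i) * of_int (a j) * (\<Sum>k<N. period N (i + k) * cnj (period N (j + k))))"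
    by (simp only: sum_distrib_left)
  also have "\<dots> = (\<Sum>i<N. \<Sum>j<N. of_int (a i) * of_int (a j) * ((if i = j then of_nat p else 0) - of_nat m))"
    by (intro sum.cong refl) (simp add: period_orthogonality[OF N] m_def)
  also have "\<dots> = (\<Sum>i<N. \<Sum>j<N. (if i = j then of_nat p * of_int ((a i)\<^sup>2) else 0) - of_nat m * (of_int (a i) * of_int (a j)))"
  proof (intro sum.cong refl)
    fix i j
    show "of_int (a i) * of_int (a j) * ((if i = j then of_nat p else 0) - of_nat m) =
        (if i = j then of_nat p * of_int ((a i)\<^sup>2) else 0) - of_nat m * (of_int (a i) * of_int (a j) :: complex)"
      by (cases "i = j") (simp_all add: right_diff_distrib power2_eq_square mult_ac)
  qed
  also have "\<dots> = (\<Sum>i<N. of_nat p * of_int ((a i)\<^sup>2)) - of_nat m * (\<Sum>i<N. \<Sum>j<N. of_int (a i) * of_int (a j))"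
    by (simp add: sum_subtractf sum_distrib_left)
  also have "(\<Sum>i<N. \<Sum>j<N. of_int (a i) * of_int (a j)) = (of_int ((\<Sum>i<N. a i)\<^sup>2) :: complex)"
    by (simp add: power2_eq_square sum_product)
  finally show ?thesis by (simp add: m_def sum_distrib_left)
qed

section \<open>The embeddings of the subfield and its trace form\<close>

locale cyclotomic_lattice = cyclotomic_subfield +
  fixes r1 r2 :: nat and emb :: "nat \<Rightarrow> complex \<Rightarrow> complex"
  assumes enum: "embedding_enumeration K s r1 r2 emb"
    and s_even: "even s" and index_odd: "odd ((p - 1) div s)"
begin

abbreviation "m \<equiv> (p - 1) div s"

abbreviation "can \<equiv> canonical_embedding r1 r2 emb"

lemma s_mult_m: "s * m = p - 1" using s_dvd by simp

lemma period_s_in_K: "period s i \<in> K" using period_in_K N_eq by metis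

lemma bij_emb: "bij_betw emb {..<s} (embeddings K)"
  using enum unfolding embedding_enumeration_def by blast

lemma embeddings_eq: "embeddings K = (\<lambda>k. restrict (S ^^ k) K) ` {..<s}"
proof (rule embeddings_K)
  show "card (embeddings K) = s" using bij_betw_same_card[OF bij_emb] by simp
qed

text \<open>A sum over all embeddings ignores their order, so the arbitrary enumeration may be
  replaced by the powers of \<open>S\<close>.\<close>

lemma sum_emb: "(\<Sum>j<s. g (emb j)) = (\<Sum>k<s. g (restrict (S ^^ k) K))"
proof -
  have "(\<Sum>j<s. g (emb j)) = (\<Sum>f\<in>embeddings K. g f)" by (rule sum.reindex_bij_betw[OF bij_emb])
  also have "\<dots> = (\<Sum>k<s. g (restrict (S ^^ k) K))"
    unfolding embeddings_eq by (simp add: sum.reindex[OF inj_restrict_S_pow])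
  finally show ?thesis .
qed

lemma emb_in_embeddings: "j < s \<Longrightarrow> emb j \<in> embeddings K"
  using bij_emb by (auto simp: bij_betw_def)

text \<open>Complex conjugation is the power \<open>(p - 1)/2\<close> of \<open>S\<close>, which moves \<open>K\<close> as \<open>m\<close> is odd.\<close>

lemma r1_eq_0: "r1 = 0"
proof (rule ccontr)
  let ?h = "(p - 1) div 2"
  assume "r1 \<noteq> 0"
  then have "emb 0 ` K \<subseteq> \<real>" and "0 < s"
    using enum s_pos by (auto simp: embedding_enumeration_def)
  then obtain k where k: "emb 0 = restrict (S ^^ k) K"
    using emb_in_embeddings[of 0] embeddings_eq by auto
  have "emb 0 (period s 0) \<in> \<real>" using \<open>emb 0 ` K \<subseteq> \<real>\<close> period_s_in_K by blast
  then have real: "period s k \<in> \<real>" by (simp add: k period_s_in_K S_pow_period_shift)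
  have ev: "even (p - 1)" using s_even s_dvd dvd_trans by blast
  have "period s k = cnj (period s k)" using real by (simp add: Reals_cnj_iff)
  also have "\<dots> = period s (k + ?h)"
    unfolding period_def by (simp add: cnj_\<omega>[OF ev] add_ac)
  finally have "period s (k mod s) = period s ((k + ?h) mod s)"
    by (simp add: period_mod[OF s_dvd])
  then have "k mod s = (k + ?h) mod s"
    using s_pos by (intro period_inj[OF s_dvd]) auto
  then have "[k + ?h = k + 0] (mod s)" by (simp add: cong_def)
  then have "s dvd ?h" by (simp only: cong_add_lcancel_nat cong_0_iff)
  then obtain q where q: "?h = s * q" by blast
  then have "s * m = s * (2 * q)" using ev s_mult_m by (metis dvd_mult_div_cancel mult.left_commute)
  then show False using s_pos index_odd by simp
qed

lemma s_eq: "s = 2 * r2" using enum r1_eq_0 by (simp add: embedding_enumeration_def)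

lemma can_carrier: "can x \<in> carrier_vec s"
  using s_eq r1_eq_0 by (simp add: canonical_embedding_def)

text \<open>The two coordinates of a conjugate pair contribute
  \<open>Re (emb j x * cnj (emb j y))\<close>. The sum over all embeddings counts every pair twice,
  whence the division by 2.\<close>

lemma can_scalar_prod:
  assumes x: "x \<in> K" and y: "y \<in> K"
  shows "can x \<bullet> can y = Re (\<Sum>k<s. (S ^^ k) x * cnj ((S ^^ k) y)) / 2"
proof -
  let ?g = "\<lambda>j. emb j x * cnj (emb j y)"
  have conj: "emb (r2 + j) z = cnj (emb j z)" if "j < r2" "z \<in> K" for j z
    using enum that r1_eq_0 by (simp add: embedding_enumeration_def)
  have "can x \<bullet> can y = (\<Sum>i<2 * r2. can x $ i * can y $ i)"
    using can_carrier[of y] s_eq by (simp add: scalar_prod_def lessThan_atLeast0)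
  also have "\<dots> = (\<Sum>j<r2. can x $ (2 * j) * can y $ (2 * j) + can x $ (2 * j + 1) * can y $ (2 * j + 1))"
    by (rule sum_lessThan_double)
  also have "\<dots> = (\<Sum>j<r2. Re (?g j))"
    using r1_eq_0 by (intro sum.cong) (auto simp: canonical_embedding_def)
  finally have "can x \<bullet> can y = (\<Sum>j<r2. Re (?g j))" .
  moreover have "Re (\<Sum>j<s. ?g j) = 2 * (\<Sum>j<r2. Re (?g j))"
  proof -
    have "(\<Sum>j<s. ?g j) = (\<Sum>j<r2. ?g j) + (\<Sum>j<r2. ?g (r2 + j))"
      using s_eq by (simp only: mult_2 sum_lessThan_add)
    also have "(\<Sum>j<r2. ?g (r2 + j)) = (\<Sum>j<r2. cnj (?g j))"
      using x y by (intro sum.cong) (simp_all add: conj)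
    finally show ?thesis by simp
  qed
  moreover have "(\<Sum>j<s. ?g j) = (\<Sum>k<s. (S ^^ k) x * cnj ((S ^^ k) y))"
    using sum_emb[of "\<lambda>f. f x * cnj (f y)"] x y by simp
  ultimately show ?thesis by simp
qed

section \<open>The lattice spanned by the periods\<close>

definition period_mat :: "real mat" where
  "period_mat = mat s s (\<lambda>(i, j). can (period s j) $ i)"

lemma period_mat_carrier: "period_mat \<in> carrier_mat s s" by (simp add: period_mat_def)

lemma col_period_mat: "j < s \<Longrightarrow> col period_mat j = can (period s j)"
  using can_carrier[of "period s j"] by (intro eq_vecI) (auto simp: period_mat_def)

lemma gram_period_mat:
  "transpose_mat period_mat * period_mat =
    mat s s (\<lambda>(i, j). (if i = j then real p / 2 else 0) - real m / 2)"
proof (rule eq_matI)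
  fix i j assume "i < dim_row (mat s s (\<lambda>(i, j). (if i = j then real p / 2 else 0) - real m / 2))"
    "j < dim_col (mat s s (\<lambda>(i, j). (if i = j then real p / 2 else 0) - real m / 2))"
  then have ij: "i < s" "j < s" by auto
  have "(transpose_mat period_mat * period_mat) $$ (i, j) = can (period s i) \<bullet> can (period s j)"
    using ij period_mat_carrier by (simp add: col_period_mat)
  also have "\<dots> = ((if i = j then real p else 0) - real m) / 2"
    using ij by (simp add: can_scalar_prod period_s_in_K S_pow_period_shift period_orthogonality[OF s_dvd])
  finally show "(transpose_mat period_mat * period_mat) $$ (i, j) =
      mat s s (\<lambda>(i, j). (if i = j then real p / 2 else 0) - real m / 2) $$ (i, j)"
    using ij by (simp add: diff_divide_distrib)
qed (use period_mat_carrier in auto)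

text \<open>The Gram matrix has the shape of \<open>det_scalar_minus_constant\<close>, whose second
  factor is 1/2 because \<open>s * m = p - 1\<close>.\<close>

lemma det_period_mat: "(det period_mat)\<^sup>2 = real p ^ (s - 1) / 2 ^ s"
proof -
  have "real s * real m = real p - 1"
    using s_mult_m p_gt_1 by (metis of_nat_1 of_nat_diff of_nat_mult less_imp_le)
  then have "real p / 2 - real s * (real m / 2) = 1 / 2" by (simp add: field_simps)
  then have "(det period_mat)\<^sup>2 = (real p / 2) ^ (s - 1) * (1 / 2)"
    using det_gram[OF period_mat_carrier] s_pos
    by (simp only: gram_period_mat det_scalar_minus_constant)
  also have "\<dots> = real p ^ (s - 1) / 2 ^ Suc (s - 1)" by (simp add: power_divide)
  finally show ?thesis using s_pos by simp
qed

definition combination :: "int vec \<Rightarrow> complex" where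
  "combination a = (\<Sum>i<s. of_int (a $ i) * period s i)"

lemma combination_in_ring_of_integers: "combination a \<in> ring_of_integers K"
  unfolding combination_def by (rule period_combination_in_ring_of_integers)

lemma combination_in_K: "combination a \<in> K"
  using combination_in_ring_of_integers by (simp add: ring_of_integers_def)

lemma can_combination:
  assumes a: "a \<in> carrier_vec s"
  shows "can (combination a) = period_mat *\<^sub>v map_vec real_of_int a"
proof (rule eq_vecI)
  fix i assume "i < dim_vec (period_mat *\<^sub>v map_vec real_of_int a)"
  then have i: "i < s" by (simp add: period_mat_def)
  \<comment> \<open>As \<open>r1 = 0\<close>, coordinate \<open>i\<close> is the real or imaginary
    part of the embedding number \<open>i div 2\<close>.\<close>
  define j where "j = i div 2"
  have j: "j < s" using i unfolding j_def by simp
  interpret e: subfield_hom K "emb j"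
    using emb_in_embeddings[OF j] K by unfold_locales (simp_all add: embeddings_iff_field_hom)
  have ej: "emb j (combination a) = (\<Sum>l<s. of_int (a $ l) * emb j (period s l))"
    unfolding combination_def
    by (simp add: e.hom_sum e.hom_mult e.hom_of_int period_s_in_K
        complex_subfield_mult complex_subfield_of_int K)
  have ci: "can x $ i = (if even i then Re (emb j x) else Im (emb j x))" for x
    using i s_eq r1_eq_0 by (simp add: canonical_embedding_def j_def)
  have "can (combination a) $ i = (\<Sum>l<s. can (period s l) $ i * real_of_int (a $ l))"
    by (simp add: ci ej mult.commute)
  then show "can (combination a) $ i = (period_mat *\<^sub>v map_vec real_of_int a) $ i"
    using i a by (auto simp: period_mat_def scalar_prod_def lessThan_atLeast0 intro!: sum.cong)
qed (use can_carrier[of "combination a"] in \<open>simp add: period_mat_def\<close>)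

lemma norm_can_combination:
  "can (combination a) \<bullet> can (combination a) =
    real_of_int (int p * (\<Sum>i<s. (a $ i)\<^sup>2) - int m * (\<Sum>i<s. a $ i)\<^sup>2) / 2"
proof -
  have "(S ^^ k) (combination a) = (\<Sum>i<s. of_int (a $ i) * period s (i + k))" for k
    unfolding combination_def
    by (simp add: S_pow_K.hom_sum S_pow_K.hom_mult S_pow_K.hom_of_int period_s_in_K
        S_pow_period_shift complex_subfield_mult complex_subfield_of_int K)
  then have "can (combination a) \<bullet> can (combination a) =
     Re (of_int (int p * (\<Sum>i<s. (a $ i)\<^sup>2) - int m * (\<Sum>i<s. a $ i)\<^sup>2)) / 2"
    using period_norm_form[OF s_dvd, of "\<lambda>i. a $ i"]
    by (simp only: can_scalar_prod combination_in_K)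
  moreover have "Re (of_int n) = real_of_int n" for n by simp
  ultimately show ?thesis by (simp only:)
qed

end

section \<open>The center density\<close>

context cyclotomic_lattice
begin

context
  fixes \<alpha> :: int
  assumes code: "root_code (int p) s \<alpha>"
begin

interpretation C: root_code "int p" s \<alpha> by (rule code)

section \<open>The lattice of the code: basis, minimum and volume\<close>

definition code_mat :: "real mat" where
  "code_mat = period_mat * map_mat real_of_int (C.generator_mat (s div 2 + 1))"

definition code_lattice :: "real vec set" where
  "code_lattice = (\<lambda>a. can (combination a)) ` {a \<in> carrier_vec s. ($) a \<in> C.code (s div 2 + 1)}"

lemma dim_le: "s div 2 + 1 \<le> s"
  using s_pos s_even by presburger

lemma generator_mat_carrier: "C.generator_mat k \<in> carrier_mat s s"
  by (simp add: C.generator_mat_def)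

text \<open>The periods contribute \<open>s - 1\<close> to the exponent of \<open>p\<close>, and the
  index of the code, squared, contributes \<open>s + 2\<close>.\<close>

lemma det_code_mat: "(det code_mat)\<^sup>2 = real p ^ (2 * s + 1) / 2 ^ s"
proof -
  have "det code_mat = det period_mat * real p ^ (s div 2 + 1)"
    unfolding code_mat_def using C.det_generator_mat[OF dim_le]
    by (subst det_mult[OF period_mat_carrier]) (simp_all add: generator_mat_carrier)
  then have "(det code_mat)\<^sup>2 = real p ^ (s - 1) / 2 ^ s * (real p ^ (s div 2 + 1))\<^sup>2"
    by (simp only: power_mult_distrib det_period_mat)
  also have "\<dots> = real p ^ (s - 1 + 2 * (s div 2 + 1)) / 2 ^ s"
    by (simp only: power_mult[symmetric] power_add[of _ "s - 1"] mult.commute[of 2] times_divide_eq_left)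
  also have "s - 1 + 2 * (s div 2 + 1) = 2 * s + 1" using s_pos s_even by presburger
  finally show ?thesis .
qed

text \<open>The generator matrix maps the integer vectors onto the code vectors, and
  \<open>can_combination\<close> is linear in the coordinates, so the product of the two matrices is
  a basis.\<close>

lemma code_lattice_basis: "is_lattice_basis s code_mat code_lattice"
  unfolding is_lattice_basis_def
proof (intro conjI)
  show carrier: "code_mat \<in> carrier_mat s s"
    unfolding code_mat_def using period_mat_carrier generator_mat_carrier
    by (intro mult_carrier_mat) auto
  have "(det code_mat)\<^sup>2 \<noteq> 0" unfolding det_code_mat using p_gt_1 by simp
  then show "invertible_mat code_mat" using invertible_mat_iff_det_nonzero[OF carrier] by auto
  let ?k = "s div 2 + 1"
  let ?G = "C.generator_mat ?k"
  have G_vec: "?G *\<^sub>v c \<in> carrier_vec s" if "c \<in> carrier_vec s" for c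
    by (rule mult_mat_vec_carrier[OF generator_mat_carrier that])
  have can_G: "can (combination (?G *\<^sub>v c)) = code_mat *\<^sub>v map_vec real_of_int c"
    if c: "c \<in> carrier_vec s" for c
  proof -
    have "can (combination (?G *\<^sub>v c)) = period_mat *\<^sub>v map_vec real_of_int (?G *\<^sub>v c)"
      by (rule can_combination[OF G_vec[OF c]])
    also have "map_vec real_of_int (?G *\<^sub>v c) = map_mat real_of_int ?G *\<^sub>v map_vec real_of_int c"
      using generator_mat_carrier c by (intro of_int_hom.mult_mat_vec_hom) auto
    also have "period_mat *\<^sub>v (map_mat real_of_int ?G *\<^sub>v map_vec real_of_int c) =
        code_mat *\<^sub>v map_vec real_of_int c"
      unfolding code_mat_def using period_mat_carrier generator_mat_carrier c
      by (subst assoc_mult_mat_vec[of _ s s _ s]) auto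
    finally show ?thesis .
  qed
  have "{a \<in> carrier_vec s. ($) a \<in> C.code ?k} = (\<lambda>c. ?G *\<^sub>v c) ` carrier_vec s"
  proof (intro subset_antisym subsetI)
    fix a assume a: "a \<in> {a \<in> carrier_vec s. ($) a \<in> C.code ?k}"
    then obtain c where c: "c \<in> carrier_vec s" "\<And>i. i < s \<Longrightarrow> a $ i = (?G *\<^sub>v c) $ i"
      using C.code_spanned[OF _ dim_le, of "($) a"] by blast
    have "a = ?G *\<^sub>v c"
    proof (rule eq_vecI)
      have "dim_vec (?G *\<^sub>v c) = s" using G_vec[OF c(1)] by (rule carrier_vecD)
      then show "a $ i = (?G *\<^sub>v c) $ i" if "i < dim_vec (?G *\<^sub>v c)" for i
        using that c(2) by simp
      show "dim_vec a = dim_vec (?G *\<^sub>v c)"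
        using a \<open>dim_vec (?G *\<^sub>v c) = s\<close> by simp
    qed
    then show "a \<in> (\<lambda>c. ?G *\<^sub>v c) ` carrier_vec s" using c(1) by blast
  next
    fix a assume "a \<in> (\<lambda>c. ?G *\<^sub>v c) ` carrier_vec s"
    then show "a \<in> {a \<in> carrier_vec s. ($) a \<in> C.code ?k}"
      using C.generator_mat_in_code[OF _ dim_le] G_vec by blast
  qed
  then have "code_lattice = (\<lambda>c. can (combination (?G *\<^sub>v c))) ` carrier_vec s"
    unfolding code_lattice_def by (simp add: image_image)
  also have "\<dots> = (\<lambda>c. code_mat *\<^sub>v map_vec real_of_int c) ` carrier_vec s"
    using can_G by (intro image_cong) auto
  finally show "code_lattice = {code_mat *\<^sub>v map_vec real_of_int c | c. c \<in> carrier_vec s}"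
    by auto
qed

lemma code_lattice_norm:
  assumes a: "a \<in> carrier_vec s" "($) a \<in> C.code (s div 2 + 1)" and nz: "a \<noteq> 0\<^sub>v s"
  shows "(real p)\<^sup>2 \<le> can (combination a) \<bullet> can (combination a)"
proof -
  obtain j where j: "j < s" "a $ j \<noteq> 0"
    using a nz by (metis carrier_vecD eq_vecI index_zero_vec)
  have "int m * int s = int p - 1"
    using s_mult_m p_gt_1 by (metis less_imp_le mult.commute of_nat_1 of_nat_diff of_nat_mult)
  moreover have "odd (int p)"
  proof -
    have "even (p - 1)" using s_even s_dvd dvd_trans by blast
    then show ?thesis using p_gt_1 by simp
  qed
  \<comment> \<open>With \<open>s div 2 + 1\<close> checks the hypothesis of the Parseval argument
    holds with equality.\<close>
  moreover have "s \<le> 2 * (s div 2 + 1 - 1)" using s_even by simp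
  ultimately have "2 * (int p)\<^sup>2 \<le> int p * (\<Sum>i<s. (a $ i)\<^sup>2) - int m * (\<Sum>i<s. a $ i)\<^sup>2"
    using C.code_form_lower_bound[OF a(2), of "int m" j] j index_odd by simp
  then have "real_of_int (2 * (int p)\<^sup>2) \<le> real_of_int (int p * (\<Sum>i<s. (a $ i)\<^sup>2) - int m * (\<Sum>i<s. a $ i)\<^sup>2)"
    by (simp only: of_int_le_iff)
  then show ?thesis unfolding norm_can_combination by simp
qed

lemma can_combination_zero: "can (combination (0\<^sub>v s)) = 0\<^sub>v s"
  by (subst can_combination) (auto simp: period_mat_def scalar_prod_def intro!: eq_vecI)

lemma code_lattice_packing_radius: "packing_radius s code_lattice \<ge> real p / 2"
proof (rule packing_radius_ge)
  \<comment> \<open>The first basis vector serves as a nonzero lattice vector.\<close>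
  have "code_mat *\<^sub>v map_vec real_of_int (unit_vec s 0) \<in> code_lattice"
    using code_lattice_basis unfolding is_lattice_basis_def by auto
  moreover have "code_mat *\<^sub>v map_vec real_of_int (unit_vec s 0) \<noteq> 0\<^sub>v s"
  proof
    assume 0: "code_mat *\<^sub>v map_vec real_of_int (unit_vec s 0) = 0\<^sub>v s"
    have "map_vec real_of_int (unit_vec s 0) $ 0 \<noteq> 0\<^sub>v s $ 0" using s_pos by simp
    then have "map_vec real_of_int (unit_vec s 0) \<noteq> 0\<^sub>v s" by metis
    then have "det code_mat = 0"
      using det_0_iff_vec_prod_zero_field[of code_mat s] 0 code_lattice_basis
      unfolding is_lattice_basis_def by (meson map_carrier_vec unit_vec_carrier)
    then show False using det_code_mat p_gt_1 by simp
  qed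
  ultimately show "code_lattice - {0\<^sub>v s} \<noteq> {}" by blast
  fix v assume "v \<in> code_lattice"
  then obtain a where a: "a \<in> carrier_vec s" "($) a \<in> C.code (s div 2 + 1)" "v = can (combination a)"
    unfolding code_lattice_def by blast
  define Q where "Q = int p * (\<Sum>i<s. (a $ i)\<^sup>2) - int m * (\<Sum>i<s. a $ i)\<^sup>2"
  have vv: "v \<bullet> v = real_of_int Q / 2" unfolding a(3) Q_def by (rule norm_can_combination)
  \<comment> \<open>The integer \<open>Q\<close> is therefore nonnegative, and \<open>nat\<close>
    preserves its value.\<close>
  have "0 \<le> v \<bullet> v" by (simp add: scalar_prod_def sum_nonneg)
  then have "v \<bullet> v = real (nat Q) / 2" using vv by simp
  then show "\<exists>k. v \<bullet> v = real k / 2" by blast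
next
  fix v assume v: "v \<in> code_lattice - {0\<^sub>v s}"
  then obtain a where a: "a \<in> carrier_vec s" "($) a \<in> C.code (s div 2 + 1)" "v = can (combination a)"
    unfolding code_lattice_def by blast
  then have "a \<noteq> 0\<^sub>v s" using v can_combination_zero by auto
  then show "(real p)\<^sup>2 \<le> v \<bullet> v" using code_lattice_norm a by simp
qed simp

text \<open>The volume is \<open>p ^ s * sqrt p / 2 ^ (s div 2)\<close> and the radius at least
  \<open>p / 2\<close>, so the powers \<open>p ^ s\<close> cancel.\<close>

lemma code_lattice_center_density:
  "center_density s code_lattice \<ge> 1 / (2 ^ (s div 2) * sqrt (real p))"
proof -
  have carrier: "code_mat \<in> carrier_mat s s"
    using code_lattice_basis by (simp add: is_lattice_basis_def)
  define h where "h = s div 2"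
  have s: "s = 2 * h" using s_even by (simp add: h_def)
  have sq: "real p ^ (2 * s + 1) / 2 ^ s = (real p ^ s / 2 ^ h)\<^sup>2 * real p"
    unfolding power_divide power_mult[symmetric] by (simp add: s mult.commute power_add)
  have "lattice_volume s code_lattice = sqrt ((det code_mat)\<^sup>2)"
    using lattice_volume_eq[OF code_lattice_basis] det_gram[OF carrier] by simp
  also have "\<dots> = real p ^ s / 2 ^ h * sqrt (real p)"
    unfolding det_code_mat sq by (simp add: real_sqrt_mult)
  finally have vol: "lattice_volume s code_lattice = real p ^ s / 2 ^ h * sqrt (real p)" .
  have p0: "real p > 0" using p_gt_1 by simp
  have "1 / (2 ^ h * sqrt (real p)) = (real p / 2) ^ s / (real p ^ s / 2 ^ h * sqrt (real p))"
  proof -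
    have "(2 :: real) ^ s = 2 ^ h * 2 ^ h" by (simp add: s mult_2 power_add)
    then show ?thesis using p0 by (simp add: power_divide field_simps)
  qed
  also have "\<dots> \<le> packing_radius s code_lattice ^ s / (real p ^ s / 2 ^ h * sqrt (real p))"
    using code_lattice_packing_radius p0 by (intro divide_right_mono power_mono) auto
  finally show ?thesis by (simp add: center_density_def vol h_def)
qed

text \<open>Elements of the module come with a coordinate vector, and every integer combination of
  periods is an algebraic integer of \<open>K\<close>. The bound \<open>i \<le> s div 2\<close>
  accounts for \<open>s div 2 + 1\<close> checks.\<close>

lemma M_module_eq:
  "M_module p s K (restrict S K) (rel_trace L K \<zeta>) \<alpha> =
    combination ` {a \<in> carrier_vec s. ($) a \<in> C.code (s div 2 + 1)}"
proof -
  have coord: "is_coord_vec s (restrict S K) (rel_trace L K \<zeta>) x a \<longleftrightarrow>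
      a \<in> carrier_vec s \<and> x = combination a" for x a
    unfolding is_coord_vec_def rel_trace_\<zeta> theta_pow_t combination_def ..
  have dot: "a \<bullet> mu_vec s \<alpha> i = (\<Sum>j<s. a $ j * \<alpha> ^ (j * i))" for a i
    by (auto simp: mu_vec_def scalar_prod_def lessThan_atLeast0 intro!: sum.cong)
  have code_iff: "($) a \<in> C.code (s div 2 + 1) \<longleftrightarrow> (\<forall>i \<le> s div 2. [a \<bullet> mu_vec s \<alpha> i = 0] (mod int p))" for a
    unfolding C.code_def dot cong_0_iff by (simp add: less_Suc_eq_le One_nat_def)
  show ?thesis
    unfolding M_module_def coord code_iff using combination_in_ring_of_integers by auto
qed

lemma can_M_module:
  "can ` M_module p s K (restrict S K) (rel_trace L K \<zeta>) \<alpha> = code_lattice"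
  unfolding M_module_eq code_lattice_def image_image ..

end

end

theorem mainTheorem5:
  fixes p s r1 r2 :: nat
    and \<zeta> t :: complex
    and L K :: "complex set"
    and u \<beta> \<alpha> :: int
    and \<sigma>\<^sub>u \<theta> :: "complex \<Rightarrow> complex"
    and emb :: "nat \<Rightarrow> complex \<Rightarrow> complex"
    and \<Lambda> :: "real vec set"
  assumes "prime p"
    and "s > 0" and "even s" and "s dvd p - 1" and "odd ((p - 1) div s)"
    and "primitive_root_of_unity p \<zeta>" and "L = rat_adjoin \<zeta>"
    and "complex_subfield K" and "K \<subseteq> L" and "degree_over_rat K = s"
    and "int_primroot p u"
    and "\<sigma>\<^sub>u \<in> field_automorphisms L" and "\<sigma>\<^sub>u \<zeta> = \<zeta> powi u"
    and "\<theta> = restrict \<sigma>\<^sub>u K"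
    and "t = rel_trace L K \<zeta>"
    and "int_primroot p \<beta>" and "\<alpha> = \<beta> ^ ((p - 1) div s)"
    and "embedding_enumeration K s r1 r2 emb"
    and "\<Lambda> = canonical_embedding r1 r2 emb ` M_module p s K \<theta> t \<alpha>"
  shows "full_rank_lattice s \<Lambda> \<and>
         center_density s \<Lambda> \<ge> 1 / (2 ^ (s div 2) * sqrt (real p))"
proof -
  have p0: "p > 0" using assms(1) by (rule prime_gt_0_nat)
  \<comment> \<open>The integer \<open>u\<close> enters through its least nonnegative residue, so
    that \<zeta> is raised to natural exponents only.\<close>
  interpret cyclotomic_lattice p "nat (u mod int p)" \<zeta> \<sigma>\<^sub>u K s r1 r2 emb
  proof
    show "\<sigma>\<^sub>u \<zeta> = \<zeta> ^ nat (u mod int p)"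
      using assms(13) power_int_mod_root_of_unity[OF assms(6) p0] by simp
    show "residue_primroot p (nat (u mod int p))" using assms(11) by (simp add: int_primroot_def)
  qed (use assms in auto)
  have code: "root_code (int p) s \<alpha>"
    unfolding assms(17) using assms by (intro root_code_primroot)
  have "\<Lambda> = code_lattice \<alpha>"
    unfolding assms(7,14,15,19) by (rule can_M_module[OF code])
  then show ?thesis
    using code_lattice_basis[OF code] code_lattice_center_density[OF code]
    unfolding full_rank_lattice_def by blast
qed

end
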